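(* Let $(Q,N,C_1,\dots,C_N)$ be a random vector with $N\in\{0,1,2,\dots\}\cup\{\infty\}$, $C_i\ge 0$ for all $i$, and $P(|Q|>0)>0$. Let $Z_N=\sum_{i=1}^N C_i$ and suppose $\overline{G}(x)=P(Z_N>x)\in\mathcal{R}_{-\alpha}$ with $\alpha>1$. Assume further that $E[(Q^+)^{\alpha+\epsilon}]<\infty$ and $\rho_{\alpha+\epsilon}<\infty$ for some $\epsilon>0$. Fix $\eta$ with $\rho\vee\rho_\alpha<\eta<1$. Then there exists a finite constant $K=K(\eta,\epsilon)>0$ (not depending on $n$ or $x$) such that for all $n\ge1$ and all $x\ge1$, $$P(W_n^+>x)\le K\,\eta^n\,P(Z_N>x).$$
   Context: The components of $(Q,N,C_1,\dots,C_N)$ may be arbitrarily dependent, and $Q$ is real-valued. When $N=\infty$, sums $\sum_{i=1}^N$ run over all $i\ge1$. The law of $(Q,N,C_1,\dots,C_N)$ is fixed, and constants may depend on it. Weighted branching tree: let $U=\bigcup_{k\ge0}\{1,2,3,\dots\}^k$ be the set of finite sequences of positive integers, with $\emptyset$ the empty sequence (root); for $\mathbf{i}=(i_1,\dots,i_n)\in U$ write $(\mathbf{i},j)=(i_1,\dots,i_n,j)$. To each node $\mathbf{i}$ assign an i.i.d. copy $(Q_{\mathbf i},N_{\mathbf i},C_{(\mathbf i,1)},\dots,C_{(\mathbf i,N_{\mathbf i})})$ of $(Q,N,C_1,\dots,C_N)$, the root's vector being $(Q,N,C_1,\dots,C_N)$ itself. Let $A_0=\{\emptyset\}$ and $A_n=\{(\mathbf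 i,j):\mathbf i\in A_{n-1},\ 1\le j<N_{\mathbf i}+1\}$ for $n\ge1$ (the $n$th generation). Set $\Pi_\emptyset=1$ and $\Pi_{(\mathbf i,j)}=C_{(\mathbf i,j)}\Pi_{\mathbf i}$. Define $W_n=\sum_{\mathbf i\in A_n}Q_{\mathbf i}\Pi_{\mathbf i}$ for $n\ge0$ (so $W_0=Q$). Notation: $\rho_\beta=E\left[\sum_{i=1}^N C_i^\beta\right]$ for $\beta>0$, $\rho=\rho_1$, $x\vee y=\max\{x,y\}$, $x^+=\max\{x,0\}$. $f\in\mathcal{R}_{-\alpha}$ means $f(x)=x^{-\alpha}L(x)$ for some slowly varying $L$, i.e. $L:[0,\infty)\to(0,\infty)$ with $\lim_{x\to\infty}L(\lambda x)/L(x)=1$ for every $\lambda>0$. *)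

theory Defs
  imports "HOL-Probability.Probability" "HOL-Library.Extended_Nat"
begin

section \<open>Regular variation\<close>

definition slowly_varying :: "(real \<Rightarrow> real) \<Rightarrow> bool" where
  "slowly_varying L \<longleftrightarrow>
     (\<forall>x\<ge>0. L x > 0) \<and> (\<forall>c>0. ((\<lambda>x. L (c * x) / L x) \<longlongrightarrow> 1) at_top)"

text \<open>The class of regularly varying functions of index \<open>a\<close>; the equation is only imposed for
  \<open>x > 0\<close>, since \<open>x\<^sup>a\<close> has no meaning at \<open>x = 0\<close> for negative \<open>a\<close>.\<close>

definition regularly_varying :: "real \<Rightarrow> (real \<Rightarrow> real) set" where
  "regularly_varying a = {f. \<exists>L. slowly_varying L \<and> (\<forall>x>0. f x = x powr a * L x)}"

section \<open>Weighted branching trees\<close>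

text \<open>Nodes are finite lists of positive integers, the child \<open>(v, j)\<close> of \<open>v\<close> being \<open>v @ [j]\<close>.
  As usual the weights are indexed by the child: \<open>C (v @ [j])\<close> is the \<open>j\<close>-th weight in the vector
  attached to \<open>v\<close>. In particular the root vector is \<open>(Q [], N [], C [1], C [2], \<dots>)\<close>.\<close>

definition nodes :: "nat list set" where
  "nodes = {v. \<forall>j\<in>set v. 1 \<le> j}"

definition child_indices :: "enat \<Rightarrow> nat set" where
  "child_indices m = {j. 1 \<le> j \<and> enat j < m + 1}"

text \<open>The vector attached to a node has the random length \<open>N\<close>. It is encoded by a sequence
  padded with zeros beyond \<open>N\<close>, so that the values of \<open>C (v @ [j])\<close> for \<open>j > N v\<close> play no role.\<close>

definition node_vector ::
  "(nat list \<Rightarrow> 'a \<Rightarrow> real) \<Rightarrow> (nat list \<Rightarrow> 'a \<Rightarrow> enat) \<Rightarrow> (nat list \<Rightarrow> 'a \<Rightarrow> real) \<Rightarrow>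
   nat list \<Rightarrow> 'a \<Rightarrow> real \<times> enat \<times> (nat \<Rightarrow> real)" where
  "node_vector Q N C v \<omega> =
     (Q v \<omega>, N v \<omega>, \<lambda>j. if j \<in> child_indices (N v \<omega>) then C (v @ [j]) \<omega> else 0)"

abbreviation node_vector_algebra :: "(real \<times> enat \<times> (nat \<Rightarrow> real)) measure" where
  "node_vector_algebra \<equiv> borel \<Otimes>\<^sub>M (count_space UNIV \<Otimes>\<^sub>M (\<Pi>\<^sub>M j\<in>UNIV. borel))"

text \<open>Measurability of the node vectors is part of \<open>indep_vars\<close>. Nothing is assumed about the
  dependence between the components of a single vector.\<close>

locale weighted_branching_tree = prob_space M
  for M :: "'a measure"
    and Q :: "nat list \<Rightarrow> 'a \<Rightarrow> real"
    and N :: "nat list \<Rightarrow> 'a \<Rightarrow> enat"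
    and C :: "nat list \<Rightarrow> 'a \<Rightarrow> real" +
  assumes independent: "indep_vars (\<lambda>_. node_vector_algebra) (node_vector Q N C) nodes"
    and identically_distributed: "\<And>v. v \<in> nodes \<Longrightarrow>
      distr M node_vector_algebra (node_vector Q N C v) =
      distr M node_vector_algebra (node_vector Q N C [])"

primrec generation :: "(nat list \<Rightarrow> 'a \<Rightarrow> enat) \<Rightarrow> nat \<Rightarrow> 'a \<Rightarrow> nat list set" where
  "generation N 0 \<omega> = {[]}"
| "generation N (Suc n) \<omega> = {v @ [j] | v j. v \<in> generation N n \<omega> \<and> j \<in> child_indices (N v \<omega>)}"

fun path_weight :: "(nat list \<Rightarrow> 'a \<Rightarrow> real) \<Rightarrow> nat list \<Rightarrow> 'a \<Rightarrow> real" where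
  "path_weight C v \<omega> = (if v = [] then 1 else C v \<omega> * path_weight C (butlast v) \<omega>)"

declare path_weight.simps [simp del]

lemma path_weight_Nil [simp]: "path_weight C [] \<omega> = 1"
  by (simp add: path_weight.simps)

lemma path_weight_snoc [simp]: "path_weight C (v @ [j]) \<omega> = C (v @ [j]) \<omega> * path_weight C v \<omega>"
  by (subst path_weight.simps) simp

text \<open>\<open>W\<^sub>n\<close>, the sum of \<open>Q\<^sub>v \<Pi>\<^sub>v\<close> over the \<open>n\<close>-th generation. It is taken as an unordered sum in the
  extended reals: the generation may be infinite, and no moment of the negative part of \<open>Q\<close> is
  controlled, so that the sum may diverge to \<open>-\<infinity>\<close> even when the positive terms have a finite sum.\<close>

definition generation_sum ::
  "(nat list \<Rightarrow> 'a \<Rightarrow> real) \<Rightarrow> (nat list \<Rightarrow> 'a \<Rightarrow> enat) \<Rightarrow> (nat list \<Rightarrow> 'a \<Rightarrow> real) \<Rightarrow>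
   nat \<Rightarrow> 'a \<Rightarrow> ereal" where
  "generation_sum Q N C n \<omega> =
     (\<Sum>\<^sub>\<infinity>v\<in>generation N n \<omega>. ereal (Q v \<omega> * path_weight C v \<omega>))"

text \<open>\<open>Z\<^sub>N\<close> and \<open>\<rho>\<^sub>\<beta>\<close> of the root vector. They are \<open>[0, \<infinity>]\<close>-valued, so that an infinite sum or
  expectation is not confused with the default value 0.\<close>

definition root_sum ::
  "(nat list \<Rightarrow> 'a \<Rightarrow> enat) \<Rightarrow> (nat list \<Rightarrow> 'a \<Rightarrow> real) \<Rightarrow> 'a \<Rightarrow> ennreal" where
  "root_sum N C \<omega> = (\<Sum>\<^sub>\<infinity>i\<in>child_indices (N [] \<omega>). ennreal (C [i] \<omega>))"

definition rho ::
  "'a measure \<Rightarrow> (nat list \<Rightarrow> 'a \<Rightarrow> enat) \<Rightarrow> (nat list \<Rightarrow> 'a \<Rightarrow> real) \<Rightarrow> real \<Rightarrow> ennreal" where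
  "rho M N C \<beta> =
     (\<integral>\<^sup>+\<omega>. (\<Sum>\<^sub>\<infinity>i\<in>child_indices (N [] \<omega>). ennreal (C [i] \<omega> powr \<beta>)) \<partial>M)"

end

theory Submission
  imports Defs
begin

text \<open>
  Replacing \<open>Q\<close> by \<open>Q\<^sup>+\<close> only increases \<open>W\<^sub>n\<^sup>+\<close>, and then \<open>W\<^sub>n\<^sub>+\<^sub>1 = (\<Sum>j. C\<^sub>j Y\<^sub>j)\<close>, where \<open>Y\<^sub>j\<close> is the
  sum over the \<open>n\<close>-th generation of the subtree at the \<open>j\<close>-th child of the root. The \<open>Y\<^sub>j\<close> are
  independent of each other and of the root vector. Let \<open>G x = P (Z\<^sub>N > x)\<close>. The mean of \<open>Y\<^sub>j\<close> is at
  most \<open>m \<eta>\<^sup>n\<close> because \<open>\<rho> < \<eta>\<close>, and the bound \<open>P (Y\<^sub>j > x) \<le> K \<eta>\<^sup>n G x\<close> for \<open>x \<ge> 1\<close> is proved by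
  induction on \<open>n\<close>.

  For the induction step fix the weights \<open>C\<^sub>j\<close> for a moment. The weighted sum exceeds \<open>x\<close> in one of three
  ways (\<open>weighted_sum_tail\<close>).
  \<^item> All terms are at most \<open>x / p\<close>. By a Chernoff bound this has probability at most
    \<open>e min(1, p m \<eta>\<^sup>n Z\<^sub>N / x)\<^sup>p\<close>. For an integer \<open>p > \<alpha> + \<epsilon>\<close> this truncated moment of \<open>Z\<^sub>N\<close> has an
    expectation of order \<open>\<eta>\<^sup>n G x\<close> (\<open>truncated_moment\<close>), with a factor that does not involve \<open>K\<close>.
  \<^item> One term exceeds \<open>(1 - \<delta>) x\<close>. By the induction hypothesis, regular variation and dominated
    convergence, the expectation over the weights is at most about
    \<open>\<rho>\<^sub>\<alpha> (1 - \<delta>)\<^sup>-\<^sup>\<alpha> K \<eta>\<^sup>n G x\<close> for large \<open>x\<close> (\<open>one_jump_integral\<close>).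
  \<^item> One term exceeds \<open>x / p\<close> and the others add up to more than \<open>\<delta> x\<close>. By independence this contributes
    \<open>\<zeta> K \<eta>\<^sup>n G x\<close>, where \<open>\<zeta>\<close> tends to 0 as \<open>x\<close> grows (\<open>two_jumps_integral\<close>).

  In the last two cases the induction hypothesis says nothing about terms whose weight exceeds the level
  in question. A Markov bound for these terms adds another multiple of \<open>\<eta>\<^sup>n G x\<close> that is free of \<open>K\<close>.

  Potter bounds (\<open>potter\<close>) provide the domination in both limits; the moments of order 1 and
  \<open>\<alpha> + \<epsilon>\<close> of the weights make it integrable. As \<open>\<rho>\<^sub>\<alpha> < \<eta>\<close>, the new constant is \<open>\<theta> K + B\<close> with
  \<open>\<theta> < \<eta>\<close> for \<open>x \<ge> x\<^sub>0\<close>, where \<open>\<theta>\<close>, \<open>B\<close> and \<open>x\<^sub>0\<close> do not depend on \<open>n\<close> and \<open>K\<close>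
  (\<open>generation_step_integral\<close>). Hence \<open>K \<ge> B / (\<eta> - \<theta>)\<close> reproduces itself with the additional
  factor \<open>\<eta>\<close>, and for \<open>1 \<le> x < x\<^sub>0\<close> Markov's inequality suffices (\<open>branch_sum_tail\<close>).
\<close>

section \<open>Potter bounds for regularly varying tails\<close>

lemma power_two_bracket:
  fixes r :: real
  assumes "r \<ge> 1"
  obtains k :: nat where "2 ^ k \<le> r" "r < 2 ^ Suc k"
proof -
  obtain n where n: "r < 2 ^ n" using real_arch_pow[of 2 r] by auto
  define k where "k = (LEAST n. r < 2 ^ n)"
  have 1: "r < 2 ^ k" unfolding k_def using n by (rule LeastI)
  then have "k \<noteq> 0" using assms by (cases k) auto
  then obtain k' where k': "k = Suc k'" by (cases k) auto
  have "\<not> r < 2 ^ k'" using not_less_Least[of k' "\<lambda>n. r < 2 ^ n"] k' k_def by auto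
  then show thesis using that[of k'] 1 k' by auto
qed

text \<open>A regularly varying tail of index \<open>-\<alpha>\<close>, together with the order \<open>b\<close> of the moments that are available;
  it is \<open>\<alpha> + \<epsilon>\<close> in the application. The gaps \<open>1 < \<alpha> < b\<close> are what the Potter bounds below rest on.\<close>

locale regular_tail =
  fixes G :: "real \<Rightarrow> real" and \<alpha> b :: real
  assumes anti: "antimono G"
    and G_le1: "G x \<le> 1"
    and rv: "G \<in> regularly_varying (- \<alpha>)"
    and \<alpha>_gt1: "1 < \<alpha>" and b_gt: "\<alpha> < b"
begin

lemma G_pos: "0 < G x"
proof -
  obtain L where L: "slowly_varying L" "\<And>x. x > 0 \<Longrightarrow> G x = x powr (- \<alpha>) * L x"
    using rv unfolding regularly_varying_def by blast
  have "0 < G (max x 1)"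
    using L unfolding slowly_varying_def by (simp add: less_max_iff_disj)
  also have "\<dots> \<le> G x" using anti by (auto simp: antimono_def)
  finally show ?thesis .
qed

lemma G_mono: "x \<le> y \<Longrightarrow> G y \<le> G x"
  using anti by (auto simp: antimono_def)

lemma G_measurable [measurable]: "G \<in> borel_measurable borel"
proof -
  have "mono (\<lambda>x. - G x)" using anti by (auto simp: antimono_def mono_def)
  then have "(\<lambda>x. - (- G x)) \<in> borel_measurable borel"
    by (intro borel_measurable_uminus borel_measurable_mono)
  then show ?thesis by simp
qed

lemma G_ratio: "0 < c \<Longrightarrow> ((\<lambda>x. G (c * x) / G x) \<longlongrightarrow> c powr (- \<alpha>)) at_top"
proof -
  assume c: "0 < c"
  obtain L where L: "slowly_varying L" "\<And>x. x > 0 \<Longrightarrow> G x = x powr (- \<alpha>) * L x"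
    using rv unfolding regularly_varying_def by blast
  have "((\<lambda>x. c powr (- \<alpha>) * (L (c * x) / L x)) \<longlongrightarrow> c powr (- \<alpha>) * 1) at_top"
    using L(1) c unfolding slowly_varying_def by (intro tendsto_intros) auto
  moreover have "\<forall>\<^sub>F x in at_top. c powr (- \<alpha>) * (L (c * x) / L x) = G (c * x) / G x"
    using eventually_gt_at_top[of 0]
  proof eventually_elim
    case (elim x)
    then show ?case using c L(2)[of x] L(2)[of "c * x"] by (simp add: powr_mult)
  qed
  ultimately show ?thesis by (auto dest: Lim_transform_eventually)
qed

text \<open>The ratio \<open>G (2 x) / G x\<close> tends to \<open>2\<^sup>-\<^sup>\<alpha>\<close>, which lies strictly between \<open>2\<^sup>-\<^sup>b\<close> and \<open>1/2\<close>. From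
  some point on it stays between these two numbers, and iteration compares \<open>G\<close> with the powers
  \<open>x\<^sup>-\<^sup>1\<close> and \<open>x\<^sup>-\<^sup>b\<close>. Dyadic steps are enough because \<open>G\<close> is monotone.\<close>

lemma doubling:
  obtains x\<^sub>1 where "x\<^sub>1 \<ge> 1"
    "\<And>k y. y \<ge> x\<^sub>1 \<Longrightarrow> G (2 ^ k * y) \<le> G y / 2 ^ k"
    "\<And>k y. y \<ge> x\<^sub>1 \<Longrightarrow> G y \<le> (2 ^ k) powr b * G (2 ^ k * y)"
proof -
  have lim: "((\<lambda>x. G (2 * x) / G x) \<longlongrightarrow> 2 powr (- \<alpha>)) at_top" by (rule G_ratio) simp
  have "(2::real) powr (- \<alpha>) < 2 powr (- 1)" using \<alpha>_gt1 by (intro powr_less_mono) auto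
  then have "(2::real) powr (- \<alpha>) < 1 / 2" by (simp add: powr_minus)
  then have e1: "\<forall>\<^sub>F x in at_top. G (2 * x) / G x < 1 / 2" using lim order_tendstoD(2) by blast
  have "(2::real) powr (- b) < 2 powr (- \<alpha>)" using b_gt by (intro powr_less_mono) auto
  then have e2: "\<forall>\<^sub>F x in at_top. 2 powr (- b) < G (2 * x) / G x" using lim order_tendstoD(1) by blast
  from eventually_conj[OF e1 e2] obtain x0 where
    x0: "\<And>x. x \<ge> x0 \<Longrightarrow> G (2 * x) / G x < 1 / 2 \<and> 2 powr (- b) < G (2 * x) / G x"
    by (auto simp: eventually_at_top_linorder)
  define x1 where "x1 = max x0 1"
  have big: "x1 \<le> 2 ^ k * y" if "y \<ge> x1" for y k
  proof -
    have "1 * y \<le> 2 ^ k * y" using that unfolding x1_def by (intro mult_right_mono) auto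
    then show ?thesis using that by simp
  qed
  have s1: "G (2 * y) \<le> G y / 2" if "y \<ge> x1" for y
    using x0[of y] that G_pos[of y] unfolding x1_def by (simp add: field_simps)
  have s2: "G y \<le> 2 powr b * G (2 * y)" if "y \<ge> x1" for y
    using x0[of y] that G_pos[of y] unfolding x1_def by (simp add: field_simps powr_minus)
  show thesis
  proof (rule that[of x1])
    show "x1 \<ge> 1" unfolding x1_def by simp
  next
    fix k y assume y: "y \<ge> x1"
    show "G (2 ^ k * y) \<le> G y / 2 ^ k"
    proof (induction k)
      case (Suc k)
      have "G (2 ^ Suc k * y) = G (2 * (2 ^ k * y))" by (simp add: mult.assoc)
      also have "\<dots> \<le> G (2 ^ k * y) / 2" by (rule s1[OF big[OF y]])
      also have "\<dots> \<le> G y / 2 ^ Suc k" using Suc by (simp add: field_simps)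
      finally show ?case .
    qed simp
    show "G y \<le> (2 ^ k) powr b * G (2 ^ k * y)"
    proof (induction k)
      case (Suc k)
      have "G y \<le> (2 ^ k) powr b * G (2 ^ k * y)" by (rule Suc)
      also have "\<dots> \<le> (2 ^ k) powr b * (2 powr b * G (2 * (2 ^ k * y)))"
        by (intro mult_left_mono s2 big y) simp
      also have "\<dots> = (2 ^ Suc k) powr b * G (2 ^ Suc k * y)"
        by (simp add: powr_mult mult_ac)
      finally show ?case .
    qed simp
  qed
qed

text \<open>A Potter bound that is uniform in all \<open>c > 0\<close> and \<open>x \<ge> 1\<close>: the term \<open>c\<close> serves for \<open>c \<le> 1\<close> and
  \<open>c\<^sup>b\<close> for \<open>c \<ge> 1\<close>. Its two summands are the weights whose moments are assumed to be finite, so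
  the right-hand side is integrable when \<open>c\<close> is a random weight, which makes it the dominating
  function of all limits below. Arguments below the threshold \<open>x1\<close> of the doubling estimates are
  absorbed into \<open>A\<close>, using \<open>G \<le> 1\<close> and monotonicity.\<close>

lemma potter:
  obtains A where "A \<ge> 1" "\<And>c x. 0 < c \<Longrightarrow> 1 \<le> x \<Longrightarrow> G (x / c) \<le> A * (c + c powr b) * G x"
proof -
  obtain x1 where x1: "x1 \<ge> 1"
    and dn: "\<And>k y. y \<ge> x1 \<Longrightarrow> G (2 ^ k * y) \<le> G y / 2 ^ k"
    and up: "\<And>k y. y \<ge> x1 \<Longrightarrow> G y \<le> (2 ^ k) powr b * G (2 ^ k * y)"
    using doubling by blast
  have dn': "G (d * y) \<le> 2 / d * G y" if "d \<ge> 1" "y \<ge> x1" for d y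
  proof -
    obtain k where k: "2 ^ k \<le> d" "d < 2 ^ Suc k" using power_two_bracket[OF \<open>d \<ge> 1\<close>] .
    have "G (d * y) \<le> G (2 ^ k * y)" using k that x1 by (intro G_mono mult_right_mono) auto
    also have "\<dots> \<le> G y / 2 ^ k" by (rule dn[OF that(2)])
    also have "\<dots> \<le> 2 / d * G y" using k that G_pos[of y] by (simp add: field_simps)
    finally show ?thesis .
  qed
  have up': "G y \<le> (2 * d) powr b * G (d * y)" if "d \<ge> 1" "y \<ge> x1" for d y
  proof -
    obtain k where k: "2 ^ k \<le> d" "d < 2 ^ Suc k" using power_two_bracket[OF \<open>d \<ge> 1\<close>] .
    have "G y \<le> (2 ^ Suc k) powr b * G (2 ^ Suc k * y)" by (rule up[OF that(2)])
    also have "\<dots> \<le> (2 * d) powr b * G (d * y)"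
    proof (rule mult_mono)
      show "(2 ^ Suc k) powr b \<le> (2 * d) powr b" using k \<alpha>_gt1 b_gt by (intro powr_mono2) auto
      have "d * y \<le> 2 ^ Suc k * y" using k that x1 by (intro mult_right_mono) auto
      then show "G (2 ^ Suc k * y) \<le> G (d * y)" by (rule G_mono)
    qed (use less_imp_le[OF G_pos] in auto)
    finally show ?thesis .
  qed
  \<comment> \<open>the two constants come from the ranges \<open>c \<le> 1\<close> and \<open>c \<ge> 1\<close>\<close>
  define A where "A = max (2 * x1) (2 powr b / G x1)"
  show thesis
  proof (rule that[of A])
    show "A \<ge> 1" unfolding A_def using x1 by auto
    fix c x :: real assume c: "0 < c" and x: "1 \<le> x"
    have A0: "0 \<le> A" "2 * x1 \<le> A" "2 powr b / G x1 \<le> A" unfolding A_def using x1 by auto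
    show "G (x / c) \<le> A * (c + c powr b) * G x"
    proof (cases "c \<le> 1")
      case True
      have "G (x / c) \<le> 2 * x1 * c * G x"
      proof (cases "x \<ge> x1")
        case xx: True
        have "G (x / c) \<le> 2 * c * G x" using dn'[of "1 / c" x] c True xx by simp
        also have "\<dots> \<le> 2 * x1 * c * G x"
          using x1 c less_imp_le[OF G_pos[of x]] by (intro mult_right_mono) auto
        finally show ?thesis .
      next
        case False
        show ?thesis
        proof (cases "1 / c \<ge> x1")
          case cc: True
          have "G (x / c) \<le> G (1 / (c * x1) * x1)"
            using c x x1 by (intro G_mono) (simp add: field_simps)
          also have "\<dots> \<le> 2 / (1 / (c * x1)) * G x1"
            using cc c x1 by (intro dn') (auto simp: field_simps)
          also have "\<dots> \<le> 2 * x1 * c * G x" using False c x1 G_mono[of x x1] by (simp add: mult_ac)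
          finally show ?thesis .
        next
          case cc: False
          have "G (x / c) \<le> G x" using c True x by (intro G_mono) (simp add: field_simps mult_left_le)
          also have "\<dots> \<le> 2 * x1 * c * G x" using cc c x1 G_pos[of x] by (simp add: field_simps)
          finally show ?thesis .
        qed
      qed
      also have "\<dots> \<le> A * (c + c powr b) * G x"
        using A0 c less_imp_le[OF G_pos] by (intro mult_right_mono mult_mono) auto
      finally show ?thesis .
    next
      case False
      have "G (x / c) \<le> 2 powr b / G x1 * c powr b * G x"
      proof (cases "x / c \<ge> x1")
        case True
        have "G (x / c) \<le> (2 * c) powr b * G (c * (x / c))" using False True by (intro up') auto
        also have "\<dots> = 2 powr b / 1 * c powr b * G x" using c by (simp add: powr_mult)
        also have "\<dots> \<le> 2 powr b / G x1 * c powr b * G x"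
          using G_le1[of x1] G_pos[of x1] less_imp_le[OF G_pos] by (intro mult_right_mono divide_left_mono) auto
        finally show ?thesis .
      next
        case nx: False
        have "G x1 * G (x / c) \<le> G x1" using G_le1[of "x / c"] G_pos[of x1] by simp
        also have "\<dots> \<le> (2 * c) powr b * G (c * x1)" using False by (intro up') auto
        also have "\<dots> \<le> (2 * c) powr b * G x"
          using nx c by (intro mult_left_mono G_mono) (auto simp: field_simps)
        also have "\<dots> = 2 powr b * c powr b * G x" using c by (simp add: powr_mult)
        finally show ?thesis using G_pos[of x1] by (simp add: field_simps)
      qed
      also have "\<dots> \<le> A * (c + c powr b) * G x"
        using A0 c less_imp_le[OF G_pos] by (intro mult_right_mono mult_mono) auto
      finally show ?thesis .
    qed
  qed
qed

text \<open>The Potter bound at \<open>c = x\<close>. It turns Markov bounds with a moment of order \<open>b\<close> into multiples of \<open>G\<close>.\<close>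

lemma power_lower_bound:
  obtains B where "B > 0" "\<And>x. 1 \<le> x \<Longrightarrow> x powr (- b) \<le> B * G x"
proof -
  obtain A where A: "A \<ge> 1" "\<And>c x. 0 < c \<Longrightarrow> 1 \<le> x \<Longrightarrow> G (x / c) \<le> A * (c + c powr b) * G x"
    using potter by blast
  show thesis
  proof (rule that[of "2 * A / G 1"])
    show "2 * A / G 1 > 0" using A G_pos[of 1] by auto
    fix x :: real assume x: "1 \<le> x"
    have "x powr 1 \<le> x powr b" using x b_gt \<alpha>_gt1 by (intro powr_mono) auto
    have "G 1 \<le> A * (x + x powr b) * G x" using A(2)[of x x] x by simp
    also have "\<dots> \<le> A * (2 * x powr b) * G x"
      using A(1) x \<open>x powr 1 \<le> _\<close> less_imp_le[OF G_pos[of x]]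
      by (intro mult_right_mono mult_left_mono) auto
    finally show "x powr (- b) \<le> 2 * A / G 1 * G x"
      using x G_pos[of 1] by (simp add: field_simps powr_minus)
  qed
qed

end

section \<open>Tails of weighted sums of independent variables\<close>

lemma powr_le_chord:
  fixes a y :: real
  assumes "1 \<le> a" "0 \<le> y" "y \<le> 1"
  shows "a powr y \<le> 1 + (a - 1) * y"
proof -
  have "exp ((1 - y) *\<^sub>R 0 + y *\<^sub>R ln a) \<le> (1 - y) * exp 0 + y * exp (ln a)"
    using assms by (intro convex_onD[OF exp_convex]) auto
  then show ?thesis using assms by (simp add: powr_def algebra_simps)
qed

text \<open>A Chernoff bound for a sum whose terms are at most \<open>t\<close>. No truncation of the variables is needed:
  on the event in question \<open>a\<^sup>p \<le> (\<Prod>j. 1 + (a - 1) c\<^sub>j Y\<^sub>j / t)\<close> by the chord bound for each factor,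
  while the expectation of this product factorises over the full, untruncated variables and is
  controlled by their means alone.\<close>

lemma (in prob_space) product_tail_bound:
  fixes Y :: "nat \<Rightarrow> 'a \<Rightarrow> ennreal" and c :: "nat \<Rightarrow> real"
  assumes ind: "indep_vars (\<lambda>_. borel) Y UNIV"
    and mean: "\<And>j. (\<integral>\<^sup>+\<omega>. Y j \<omega> \<partial>M) \<le> ennreal m"
    and c: "\<And>j. 0 \<le> c j" and cs: "(\<Sum>j. ennreal (c j)) \<le> ennreal z"
    and pos: "0 \<le> m" "0 < t" "1 \<le> a" "0 \<le> z"
  shows "emeasure M {\<omega> \<in> space M. (\<forall>j. ennreal (c j) * Y j \<omega> \<le> ennreal t)
           \<and> (\<Sum>j. ennreal (c j) * Y j \<omega>) > ennreal (real p * t)}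
         \<le> ennreal (exp ((a - 1) * m * z / t) / a ^ p)"
proof -
  have Ym [measurable]: "\<And>j. Y j \<in> borel_measurable M"
    using ind unfolding indep_vars_def by auto
  define F where "F j \<omega> = 1 + ennreal ((a - 1) * c j / t) * Y j \<omega>" for j \<omega>
  have Fm [measurable]: "\<And>j. F j \<in> borel_measurable M" unfolding F_def by measurable
  have F1: "1 \<le> F j \<omega>" for j \<omega> unfolding F_def by simp
  let ?E = "{\<omega> \<in> space M. (\<forall>j. ennreal (c j) * Y j \<omega> \<le> ennreal t)
           \<and> (\<Sum>j. ennreal (c j) * Y j \<omega>) > ennreal (real p * t)}"
  have Em [measurable]: "?E \<in> sets M" by measurable
  \<comment> \<open>all factors are at least 1, so an infinite product can be replaced by a supremum\<close>
  have point: "ennreal (a ^ p) * indicator ?E \<omega> \<le> (SUP k. \<Prod>j<k. F j \<omega>)" for \<omega>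
  proof (cases "\<omega> \<in> ?E")
    case True
    define d where "d j = enn2real (ennreal (c j) * Y j \<omega>)" for j
    have dd: "ennreal (c j) * Y j \<omega> = ennreal (d j)" for j
    proof -
      have "ennreal (c j) * Y j \<omega> \<le> ennreal t" using True by auto
      also have "\<dots> < top" by simp
      finally show ?thesis unfolding d_def by simp
    qed
    have d0: "0 \<le> d j" for j unfolding d_def by simp
    have dt: "d j \<le> t" for j
    proof -
      have "ennreal (d j) \<le> ennreal t" using True unfolding dd[symmetric] by blast
      then show ?thesis using pos by simp
    qed
    have "ennreal (real p * t) < (\<Sum>j. ennreal (d j))" using True dd by simp
    then obtain k where k: "ennreal (real p * t) < (\<Sum>j<k. ennreal (d j))"
      unfolding suminf_eq_SUP less_SUP_iff by auto
    have "(\<Sum>j<k. ennreal (d j)) = ennreal (\<Sum>j<k. d j)" using d0 by simp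
    with k have sk: "real p * t < (\<Sum>j<k. d j)" using pos by (simp add: ennreal_less_iff)
    have Fd: "F j \<omega> = ennreal (1 + (a - 1) * (d j / t))" for j
    proof -
      have "F j \<omega> = 1 + ennreal ((a - 1) / t) * (ennreal (c j) * Y j \<omega>)"
        unfolding F_def using pos c[of j] by (simp add: ennreal_mult'' [symmetric] mult.assoc[symmetric])
      also have "\<dots> = 1 + ennreal ((a - 1) / t * d j)"
        unfolding dd using pos d0[of j] by (subst ennreal_mult) auto
      also have "\<dots> = ennreal (1 + (a - 1) * (d j / t))"
        using pos d0[of j] by (subst ennreal_plus) auto
      finally show ?thesis .
    qed
    have "a ^ p = a powr real p" using pos by (simp add: powr_realpow)
    also have "\<dots> \<le> a powr (\<Sum>j<k. d j / t)"
    proof (rule powr_mono)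
      show "real p \<le> (\<Sum>j<k. d j / t)"
        using sk pos by (simp add: sum_divide_distrib[symmetric] field_simps)
    qed (use pos in auto)
    also have "\<dots> = (\<Prod>j<k. a powr (d j / t))" using pos by (simp add: powr_sum)
    also have "\<dots> \<le> (\<Prod>j<k. 1 + (a - 1) * (d j / t))"
    proof (intro prod_mono conjI)
      fix j show "a powr (d j / t) \<le> 1 + (a - 1) * (d j / t)"
        using pos d0[of j] dt[of j] by (intro powr_le_chord) auto
    qed simp
    finally have "ennreal (a ^ p) \<le> ennreal (\<Prod>j<k. 1 + (a - 1) * (d j / t))" by (rule ennreal_leI)
    also have "\<dots> = (\<Prod>j<k. F j \<omega>)" unfolding Fd using pos d0 by (subst prod_ennreal) auto
    also have "\<dots> \<le> (SUP k. \<Prod>j<k. F j \<omega>)" by (rule SUP_upper) simp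
    finally show ?thesis using True by simp
  qed simp
  have Fint: "(\<integral>\<^sup>+\<omega>. F j \<omega> \<partial>M) \<le> ennreal (exp ((a - 1) * m / t * c j))" for j
  proof -
    have "(\<integral>\<^sup>+\<omega>. F j \<omega> \<partial>M) = 1 + ennreal ((a - 1) * c j / t) * (\<integral>\<^sup>+\<omega>. Y j \<omega> \<partial>M)"
      unfolding F_def by (subst nn_integral_add) (auto simp: nn_integral_cmult emeasure_space_1)
    also have "\<dots> \<le> 1 + ennreal ((a - 1) * c j / t) * ennreal m"
      by (intro add_left_mono mult_left_mono mean) simp
    also have "\<dots> = ennreal (1 + (a - 1) * m / t * c j)"
      using pos c[of j] by (simp add: ennreal_mult[symmetric] mult_ac)
    also have "\<dots> \<le> ennreal (exp ((a - 1) * m / t * c j))"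
      by (intro ennreal_leI exp_ge_add_one_self)
    finally show ?thesis .
  qed
  have prodint: "(\<integral>\<^sup>+\<omega>. (\<Prod>j<k. F j \<omega>) \<partial>M) \<le> ennreal (exp ((a - 1) * m * z / t))" for k
  proof -
    have "indep_vars (\<lambda>_. borel) F {..<k}"
      unfolding F_def using indep_vars_subset[OF ind, of "{..<k}"]
      by (intro indep_vars_compose2[where X = Y and M' = "\<lambda>_. borel"
            and Y = "\<lambda>j y. 1 + ennreal ((a - 1) * c j / t) * y"]) auto
    then have "(\<integral>\<^sup>+\<omega>. (\<Prod>j<k. F j \<omega>) \<partial>M) = (\<Prod>j<k. \<integral>\<^sup>+\<omega>. F j \<omega> \<partial>M)"
      by (intro indep_vars_nn_integral) auto
    also have "\<dots> \<le> (\<Prod>j<k. ennreal (exp ((a - 1) * m / t * c j)))"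
      by (intro prod_mono_ennreal Fint)
    also have "\<dots> = ennreal (\<Prod>j<k. exp ((a - 1) * m / t * c j))" by (intro prod_ennreal) auto
    also have "(\<Prod>j<k. exp ((a - 1) * m / t * c j)) = exp ((a - 1) * m / t * (\<Sum>j<k. c j))"
      by (simp add: exp_sum[symmetric] sum_distrib_left)
    also have "ennreal \<dots> \<le> ennreal (exp ((a - 1) * m / t * z))"
    proof -
      have "ennreal (\<Sum>j<k. c j) = (\<Sum>j<k. ennreal (c j))" using c by simp
      also have "\<dots> \<le> (\<Sum>j. ennreal (c j))" by (rule sum_le_suminf) auto
      finally have "ennreal (\<Sum>j<k. c j) \<le> ennreal z" using cs by simp
      then have "(\<Sum>j<k. c j) \<le> z" using pos by simp
      then show ?thesis using pos by (intro ennreal_leI) (simp add: divide_right_mono mult_left_mono)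
    qed
    also have "(a - 1) * m / t * z = (a - 1) * m * z / t" by simp
    finally show ?thesis .
  qed
  have "ennreal (a ^ p) * emeasure M ?E = (\<integral>\<^sup>+\<omega>. ennreal (a ^ p) * indicator ?E \<omega> \<partial>M)"
    by (simp add: nn_integral_cmult)
  also have "\<dots> \<le> (\<integral>\<^sup>+\<omega>. (SUP k. \<Prod>j<k. F j \<omega>) \<partial>M)" by (intro nn_integral_mono point)
  also have "\<dots> = (SUP k. \<integral>\<^sup>+\<omega>. (\<Prod>j<k. F j \<omega>) \<partial>M)"
  proof (rule nn_integral_monotone_convergence_SUP)
    show "incseq (\<lambda>k \<omega>. \<Prod>j<k. F j \<omega>)"
    proof (intro incseq_SucI le_funI)
      fix k \<omega>
      have "(\<Prod>j<k. F j \<omega>) * 1 \<le> (\<Prod>j<k. F j \<omega>) * F k \<omega>" by (intro mult_left_mono F1) simp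
      then show "(\<Prod>j<k. F j \<omega>) \<le> (\<Prod>j<Suc k. F j \<omega>)" by (simp add: mult.commute)
    qed
  qed measurable
  also have "\<dots> \<le> ennreal (exp ((a - 1) * m * z / t))" by (intro SUP_least prodint)
  finally have le: "ennreal (a ^ p) * emeasure M ?E \<le> ennreal (exp ((a - 1) * m * z / t))" .
  have ap: "0 < a ^ p" using pos by simp
  have "emeasure M ?E = ennreal (1 / a ^ p) * (ennreal (a ^ p) * emeasure M ?E)"
    using ap by (subst mult.assoc[symmetric], subst ennreal_mult[symmetric]) (use pos in auto)
  also have "\<dots> \<le> ennreal (1 / a ^ p) * ennreal (exp ((a - 1) * m * z / t))"
    by (intro mult_left_mono le) simp
  also have "\<dots> = ennreal (exp ((a - 1) * m * z / t) / a ^ p)"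
    using ap by (simp add: ennreal_mult[symmetric])
  finally show ?thesis .
qed

lemma markov_bound:
  assumes [measurable]: "X \<in> borel_measurable M" and y: "0 < y"
  shows "emeasure M {\<omega> \<in> space M. X \<omega> > ennreal y} \<le> ennreal (1 / y) * (\<integral>\<^sup>+\<omega>. X \<omega> \<partial>M)"
proof -
  have "emeasure M {\<omega> \<in> space M. X \<omega> > ennreal y} \<le> emeasure M {\<omega> \<in> space M. 1 \<le> ennreal (1 / y) * X \<omega>}"
  proof (intro emeasure_mono subsetI)
    fix \<omega> assume "\<omega> \<in> {\<omega> \<in> space M. X \<omega> > ennreal y}"
    then have "\<omega> \<in> space M" "ennreal y \<le> X \<omega>" by auto
    then have "ennreal (1 / y) * ennreal y \<le> ennreal (1 / y) * X \<omega>" by (intro mult_left_mono) auto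
    then show "\<omega> \<in> {\<omega> \<in> space M. 1 \<le> ennreal (1 / y) * X \<omega>}"
      using y \<open>\<omega> \<in> space M\<close> by (simp add: ennreal_mult[symmetric])
  qed measurable
  also have "\<dots> \<le> ennreal (1 / y) * (\<integral>\<^sup>+\<omega>. X \<omega> * indicator (space M) \<omega> \<partial>M)"
    using nn_integral_Markov_inequality[of X "space M" M "ennreal (1 / y)"] by simp
  also have "(\<integral>\<^sup>+\<omega>. X \<omega> * indicator (space M) \<omega> \<partial>M) = (\<integral>\<^sup>+\<omega>. X \<omega> \<partial>M)"
    by (intro nn_integral_cong) auto
  finally show ?thesis .
qed

lemma weighted_sum_mean:
  fixes Y :: "nat \<Rightarrow> 'a \<Rightarrow> ennreal"
  assumes [measurable]: "\<And>j. Y j \<in> borel_measurable M"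
    and mean: "\<And>j. (\<integral>\<^sup>+\<omega>. Y j \<omega> \<partial>M) \<le> m"
  shows "(\<integral>\<^sup>+\<omega>. (\<Sum>j. c j * Y j \<omega>) \<partial>M) \<le> m * (\<Sum>j. c j)"
proof -
  have "(\<integral>\<^sup>+\<omega>. (\<Sum>j. c j * Y j \<omega>) \<partial>M) = (\<Sum>j. c j * (\<integral>\<^sup>+\<omega>. Y j \<omega> \<partial>M))"
    by (simp add: nn_integral_suminf nn_integral_cmult)
  also have "\<dots> \<le> (\<Sum>j. c j * m)" by (intro suminf_le mult_left_mono mean) auto
  finally show ?thesis by (simp add: mult.commute)
qed

text \<open>The Chernoff bound for \<open>t = x / p\<close>, optimised over \<open>a\<close>. If \<open>m z \<ge> t\<close> or \<open>m z = 0\<close> the choice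
  \<open>a = t / (m z)\<close> is unavailable; the bound is then trivial, respectively follows from the mean
  being 0.\<close>

lemma (in prob_space) small_jumps_bound:
  fixes Y :: "nat \<Rightarrow> 'a \<Rightarrow> ennreal" and c :: "nat \<Rightarrow> real"
  defines "z \<equiv> (\<Sum>j. ennreal (c j))"
  assumes ind: "indep_vars (\<lambda>_. borel) Y UNIV"
    and mean: "\<And>j. (\<integral>\<^sup>+\<omega>. Y j \<omega> \<partial>M) \<le> ennreal m" and m: "0 \<le> m"
    and c: "\<And>j. 0 \<le> c j" and x: "0 < x" and p: "0 < p"
  shows "emeasure M {\<omega> \<in> space M. (\<forall>j. ennreal (c j) * Y j \<omega> \<le> ennreal (x / real p))
           \<and> (\<Sum>j. ennreal (c j) * Y j \<omega>) > ennreal x}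
         \<le> ennreal (exp 1) * min 1 (ennreal (m * real p / x) * z) ^ p" (is "emeasure M ?E \<le> _")
proof -
  have Ym [measurable]: "\<And>j. Y j \<in> borel_measurable M"
    using ind unfolding indep_vars_def by auto
  consider "1 \<le> ennreal (m * real p / x) * z" | "ennreal m * z = 0"
    | "ennreal (m * real p / x) * z < 1" "ennreal m * z \<noteq> 0" by force
  then show ?thesis
  proof cases
    case 1
    have "emeasure M ?E \<le> ennreal 1 * 1" by (simp add: measure_le_1 emeasure_le_1)
    also have "\<dots> \<le> ennreal (exp 1) * 1" by (intro mult_right_mono ennreal_leI) auto
    finally show ?thesis using 1 by (simp add: min_absorb1)
  next
    case 2
    have "emeasure M ?E \<le> emeasure M {\<omega> \<in> space M. (\<Sum>j. ennreal (c j) * Y j \<omega>) > ennreal x}"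
      by (intro emeasure_mono) auto
    also have "\<dots> \<le> ennreal (1 / x) * (\<integral>\<^sup>+\<omega>. (\<Sum>j. ennreal (c j) * Y j \<omega>) \<partial>M)"
      by (intro markov_bound x) measurable
    also have "\<dots> \<le> ennreal (1 / x) * (ennreal m * z)"
      unfolding z_def by (intro mult_left_mono weighted_sum_mean mean) auto
    finally show ?thesis using 2 by simp
  next
    case 3
    then have m0: "0 < m" using m by (cases "m = 0") auto
    have "z \<noteq> top" using 3 m0 x p by (auto simp: ennreal_mult_top)
    then obtain y where y: "z = ennreal y" "0 \<le> y" by (cases z) auto
    then have y0: "0 < y" using 3 by (cases "y = 0") auto
    \<comment> \<open>this choice makes \<open>a m y / (x / p) = 1\<close>, so that the exponential factor is at most \<open>e\<close>\<close>
    define a where "a = x / (m * real p * y)"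
    have "m * real p / x * y < 1"
      using 3(1) y m0 x unfolding y by (simp add: ennreal_mult[symmetric] ennreal_less_iff)
    then have a: "1 < a" unfolding a_def using m0 y0 x p by (simp add: field_simps)
    have "emeasure M {\<omega> \<in> space M. (\<forall>j. ennreal (c j) * Y j \<omega> \<le> ennreal (x / real p))
           \<and> (\<Sum>j. ennreal (c j) * Y j \<omega>) > ennreal (real p * (x / real p))}
         \<le> ennreal (exp ((a - 1) * m * y / (x / real p)) / a ^ p)"
      using a y x m p by (intro product_tail_bound[OF ind mean c]) (auto simp: z_def)
    also have "(a - 1) * m * y / (x / real p) = 1 - m * y * real p / x"
      unfolding a_def using m0 y0 x p by (simp add: field_simps)
    also have "ennreal (exp (1 - m * y * real p / x) / a ^ p) \<le> ennreal (exp 1 * (1 / a) ^ p)"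
      using a m0 y0 x by (intro ennreal_leI) (simp add: power_divide divide_right_mono)
    also have "\<dots> = ennreal (exp 1) * ennreal (1 / a) ^ p"
      using a by (subst ennreal_mult) (auto simp: ennreal_power)
    also have "ennreal (1 / a) = ennreal (m * real p / x) * z"
      unfolding y a_def using m0 y0 x p by (subst ennreal_mult[symmetric]) auto
    also have "\<dots> = min 1 (ennreal (m * real p / x) * z)" using 3 by simp
    finally show ?thesis using p by simp
  qed
qed

lemma (in prob_space) indep_rest:
  fixes Y :: "nat \<Rightarrow> 'a \<Rightarrow> ennreal" and c :: "nat \<Rightarrow> real"
  assumes ind: "indep_vars (\<lambda>_. borel) Y UNIV"
  shows "indep_var borel (Y j) borel (\<lambda>\<omega>. \<Sum>i. if i = j then 0 else ennreal (c i) * Y i \<omega>)"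
proof -
  have "indep_var (\<Pi>\<^sub>M i\<in>{j}. borel) (\<lambda>\<omega>. restrict (\<lambda>i. Y i \<omega>) {j})
          (\<Pi>\<^sub>M i\<in>-{j}. borel) (\<lambda>\<omega>. restrict (\<lambda>i. Y i \<omega>) (-{j}))"
    by (rule indep_var_restrict[OF ind]) auto
  then have "indep_var borel ((\<lambda>f. f j) \<circ> (\<lambda>\<omega>. restrict (\<lambda>i. Y i \<omega>) {j})) borel
     ((\<lambda>f. \<Sum>i. if i \<in> -{j} then ennreal (c i) * f i else 0) \<circ> (\<lambda>\<omega>. restrict (\<lambda>i. Y i \<omega>) (-{j})))"
  proof (rule indep_var_compose)
    have "(\<lambda>f. if i \<in> -{j} then ennreal (c i) * f i else 0) \<in> borel_measurable (\<Pi>\<^sub>M i\<in>-{j}. borel)" for i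
      by (cases "i \<in> -{j}") auto
    then show "(\<lambda>f. \<Sum>i. if i \<in> -{j} then ennreal (c i) * f i else 0) \<in> (\<Pi>\<^sub>M i\<in>-{j}. borel) \<rightarrow>\<^sub>M borel"
      by (rule borel_measurable_suminf_order)
  qed measurable
  moreover have "(\<lambda>f. f j) \<circ> (\<lambda>\<omega>. restrict (\<lambda>i. Y i \<omega>) {j}) = Y j" by auto
  moreover have "(\<lambda>f. \<Sum>i. if i \<in> -{j} then ennreal (c i) * f i else 0) \<circ> (\<lambda>\<omega>. restrict (\<lambda>i. Y i \<omega>) (-{j}))
      = (\<lambda>\<omega>. \<Sum>i. if i = j then 0 else ennreal (c i) * Y i \<omega>)"
    by (auto simp: fun_eq_iff intro!: suminf_cong)
  ultimately show ?thesis by simp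
qed

text \<open>The principle of a single large jump, in a form that is valid for all \<open>x\<close> and all coefficients. A sum
  exceeds \<open>x\<close> only if all its terms are at most \<open>x / p\<close> (first summand of the bound), or one term
  alone exceeds \<open>(1 - \<delta>) x\<close> (second), or one term exceeds \<open>x / p\<close> and the remaining terms, which are
  independent of it, add up to more than \<open>\<delta> x\<close> (third).\<close>

lemma (in prob_space) weighted_sum_tail:
  fixes Y :: "nat \<Rightarrow> 'a \<Rightarrow> ennreal" and c :: "nat \<Rightarrow> real"
  defines "z \<equiv> (\<Sum>j. ennreal (c j))"
  assumes ind: "indep_vars (\<lambda>_. borel) Y UNIV"
    and mean: "\<And>j. (\<integral>\<^sup>+\<omega>. Y j \<omega> \<partial>M) \<le> ennreal m" and m: "0 \<le> m"
    and c: "\<And>j. 0 \<le> c j" and x: "0 < x" and p: "0 < p" and \<delta>: "0 < \<delta>" "\<delta> < 1"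
  shows "emeasure M {\<omega> \<in> space M. (\<Sum>j. ennreal (c j) * Y j \<omega>) > ennreal x}
    \<le> ennreal (exp 1) * min 1 (ennreal (m * real p / x) * z) ^ p
      + (\<Sum>j. emeasure M {\<omega> \<in> space M. ennreal (c j) * Y j \<omega> > ennreal ((1 - \<delta>) * x)})
      + (\<Sum>j. emeasure M {\<omega> \<in> space M. ennreal (c j) * Y j \<omega> > ennreal (x / real p)})
        * min 1 (ennreal (m / (\<delta> * x)) * z)"
proof -
  have Ym [measurable]: "\<And>j. Y j \<in> borel_measurable M"
    using ind unfolding indep_vars_def by auto
  define R where "R j \<omega> = (\<Sum>i. if i = j then 0 else ennreal (c i) * Y i \<omega>)" for j \<omega>
  have Rm [measurable]: "\<And>j. R j \<in> borel_measurable M" unfolding R_def by measurable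
  let ?S = "\<lambda>\<omega>. \<Sum>j. ennreal (c j) * Y j \<omega>"
  have split: "?S \<omega> = ennreal (c j) * Y j \<omega> + R j \<omega>" for j \<omega>
  proof -
    have "?S \<omega> = (\<Sum>i. (if i = j then ennreal (c j) * Y j \<omega> else 0) + (if i = j then 0 else ennreal (c i) * Y i \<omega>))"
      by (intro suminf_cong) auto
    also have "\<dots> = (\<Sum>i. if i = j then ennreal (c j) * Y j \<omega> else 0) + R j \<omega>"
      unfolding R_def by (intro suminf_add[symmetric]) auto
    also have "(\<Sum>i. if i = j then ennreal (c j) * Y j \<omega> else 0) = ennreal (c j) * Y j \<omega>"
      using suminf_finite[of "{j}" "\<lambda>i. if i = j then ennreal (c j) * Y j \<omega> else 0"] by auto
    finally show ?thesis .
  qed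
  define A where "A = {\<omega> \<in> space M. (\<forall>j. ennreal (c j) * Y j \<omega> \<le> ennreal (x / real p)) \<and> ?S \<omega> > ennreal x}"
  define B where "B j = {\<omega> \<in> space M. ennreal (c j) * Y j \<omega> > ennreal ((1 - \<delta>) * x)}" for j
  define D where "D j = {\<omega> \<in> space M. ennreal (c j) * Y j \<omega> > ennreal (x / real p)}" for j
  define H where "H j = {\<omega> \<in> space M. R j \<omega> > ennreal (\<delta> * x)}" for j
  have [measurable]: "A \<in> sets M" "\<And>j. B j \<in> sets M" "\<And>j. D j \<in> sets M" "\<And>j. H j \<in> sets M"
    unfolding A_def B_def D_def H_def by measurable
  have cover: "{\<omega> \<in> space M. ?S \<omega> > ennreal x} \<subseteq> A \<union> (\<Union>j. B j) \<union> (\<Union>j. D j \<inter> H j)"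
  proof
    fix \<omega> assume \<omega>: "\<omega> \<in> {\<omega> \<in> space M. ?S \<omega> > ennreal x}"
    show "\<omega> \<in> A \<union> (\<Union>j. B j) \<union> (\<Union>j. D j \<inter> H j)"
    proof (rule ccontr)
      assume neg: "\<not> ?thesis"
      then have "\<omega> \<notin> A" by auto
      then obtain j where j: "ennreal (x / real p) < ennreal (c j) * Y j \<omega>"
        using \<omega> unfolding A_def by (auto simp: not_le)
      then have "\<omega> \<in> D j" using \<omega> unfolding D_def by auto
      with neg have "\<omega> \<notin> H j" "\<omega> \<notin> B j" by auto
      then have "R j \<omega> \<le> ennreal (\<delta> * x)" "ennreal (c j) * Y j \<omega> \<le> ennreal ((1 - \<delta>) * x)"
        using \<omega> unfolding H_def B_def by (auto simp: not_less)
      then have "?S \<omega> \<le> ennreal ((1 - \<delta>) * x) + ennreal (\<delta> * x)" unfolding split[of \<omega> j] by (rule add_mono[rotated])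
      also have "\<dots> = ennreal x" using \<delta> x by (subst ennreal_plus[symmetric]) (auto simp: algebra_simps)
      finally show False using \<omega> by auto
    qed
  qed
  have jump: "emeasure M (D j \<inter> H j) \<le> emeasure M (D j) * min 1 (ennreal (m / (\<delta> * x)) * z)" for j
  proof -
    have "indep_var borel (Y j) borel (R j)" unfolding R_def by (rule indep_rest[OF ind])
    then have "prob ((\<lambda>\<omega>. (Y j \<omega>, R j \<omega>)) -` ({y. ennreal (c j) * y > ennreal (x / real p)} \<times> {y. y > ennreal (\<delta> * x)}) \<inter> space M)
      = prob (Y j -` {y. ennreal (c j) * y > ennreal (x / real p)} \<inter> space M) * prob (R j -` {y. y > ennreal (\<delta> * x)} \<inter> space M)"
      by (rule indep_varD) measurable
    moreover have "(\<lambda>\<omega>. (Y j \<omega>, R j \<omega>)) -` ({y. ennreal (c j) * y > ennreal (x / real p)} \<times> {y. y > ennreal (\<delta> * x)}) \<inter> space M = D j \<inter> H j"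
      unfolding D_def H_def by auto
    moreover have "Y j -` {y. ennreal (c j) * y > ennreal (x / real p)} \<inter> space M = D j" unfolding D_def by auto
    moreover have "R j -` {y. y > ennreal (\<delta> * x)} \<inter> space M = H j" unfolding H_def by auto
    ultimately have "prob (D j \<inter> H j) = prob (D j) * prob (H j)" by simp
    then have "emeasure M (D j \<inter> H j) = emeasure M (D j) * emeasure M (H j)"
      by (simp add: emeasure_eq_measure ennreal_mult)
    moreover have "emeasure M (H j) \<le> ennreal (1 / (\<delta> * x)) * (ennreal m * z)"
    proof -
      have "emeasure M (H j) \<le> emeasure M {\<omega> \<in> space M. ?S \<omega> > ennreal (\<delta> * x)}"
        unfolding H_def by (intro emeasure_mono) (auto simp: split[of _ j] intro: less_le_trans)
      also have "\<dots> \<le> ennreal (1 / (\<delta> * x)) * (\<integral>\<^sup>+\<omega>. ?S \<omega> \<partial>M)"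
        using \<delta> x by (intro markov_bound) auto
      also have "\<dots> \<le> ennreal (1 / (\<delta> * x)) * (ennreal m * z)"
        unfolding z_def by (intro mult_left_mono weighted_sum_mean mean) auto
      finally show ?thesis .
    qed
    moreover have "ennreal (1 / (\<delta> * x)) * (ennreal m * z) = ennreal (m / (\<delta> * x)) * z"
      using \<delta> x m by (simp add: mult.assoc[symmetric] ennreal_mult[symmetric])
    moreover have "emeasure M (H j) \<le> 1" by (rule emeasure_le_1)
    ultimately show ?thesis by (auto intro!: mult_left_mono)
  qed
  have "emeasure M {\<omega> \<in> space M. ?S \<omega> > ennreal x} \<le> emeasure M (A \<union> (\<Union>j. B j) \<union> (\<Union>j. D j \<inter> H j))"
    by (intro emeasure_mono cover) measurable
  also have "\<dots> \<le> emeasure M A + emeasure M (\<Union>j. B j) + emeasure M (\<Union>j. D j \<inter> H j)"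
    by (intro order_trans[OF emeasure_subadditive] add_right_mono emeasure_subadditive) measurable
  also have "\<dots> \<le> emeasure M A + (\<Sum>j. emeasure M (B j)) + (\<Sum>j. emeasure M (D j \<inter> H j))"
    by (intro add_mono order_refl emeasure_subadditive_countably) auto
  also have "\<dots> \<le> emeasure M A + (\<Sum>j. emeasure M (B j)) + (\<Sum>j. emeasure M (D j) * min 1 (ennreal (m / (\<delta> * x)) * z))"
    by (intro add_mono order_refl suminf_le jump) auto
  also have "emeasure M A \<le> ennreal (exp 1) * min 1 (ennreal (m * real p / x) * z) ^ p"
    unfolding A_def z_def by (rule small_jumps_bound[OF ind mean m c x p])
  finally show ?thesis unfolding B_def D_def by simp
qed

section \<open>Random weights with a regularly varying sum\<close>

text \<open>Writing a truncated moment as a series of tail probabilities at the dyadic levels: if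
  \<open>2\<^sup>-\<^sup>k\<^sup>-\<^sup>1 < u \<le> 2\<^sup>-\<^sup>k\<close>, the \<open>k\<close>-th term alone dominates, and for
  \<open>u > 1\<close> the term with \<open>k = 0\<close> does.\<close>

lemma min_power_le_dyadic:
  fixes u :: ennreal
  assumes "0 < p"
  shows "min 1 u ^ p \<le> (\<Sum>k. ennreal (1 / (2 ^ k) ^ p) * indicator {u. u > ennreal (1 / 2 ^ Suc k)} u)"
    (is "_ \<le> (\<Sum>k. ?f k)")
proof -
  have "\<exists>k. min 1 u ^ p \<le> ?f k \<or> u = 0"
  proof (cases "u \<le> 1")
    case True
    then have "u \<noteq> top" by (auto simp: top_unique)
    then obtain v where v: "u = ennreal v" "0 \<le> v" by (cases u) auto
    with True have v1: "v \<le> 1" by simp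
    show ?thesis
    proof (cases "v = 0")
      case False
      with v have "0 < v" by simp
      then have "1 \<le> 1 / v" using v1 by simp
      then obtain k where k: "2 ^ k \<le> 1 / v" "1 / v < 2 ^ Suc k" by (rule power_two_bracket)
      have vk: "v \<le> 1 / 2 ^ k" "1 / 2 ^ Suc k < v"
        using k \<open>0 < v\<close> by (auto simp: field_simps)
      have "min 1 u ^ p = ennreal (v ^ p)" using True v by (simp add: min_absorb2 ennreal_power)
      also have "\<dots> \<le> ennreal ((1 / 2 ^ k) ^ p)" using v vk by (intro ennreal_leI power_mono)
      also have "\<dots> = ?f k" using v vk by (simp add: ennreal_less_iff power_divide)
      finally show ?thesis by blast
    qed (use v in auto)
  next
    case False
    then have "1 < u" by simp
    moreover have "ennreal (1 / 2 ^ Suc 0) < ennreal 1" by (subst ennreal_less_iff) auto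
    ultimately have "ennreal (1 / 2 ^ Suc 0) < u" by (auto intro: less_trans)
    then have "min 1 u ^ p \<le> ?f 0" using \<open>1 < u\<close> by (simp add: min_absorb1)
    then show ?thesis by blast
  qed
  then obtain k where "min 1 u ^ p \<le> ?f k \<or> u = 0" ..
  moreover have "?f k \<le> (\<Sum>k. ?f k)" proof -
    have "sum ?f {k} \<le> (\<Sum>k. ?f k)" by (rule sum_le_suminf) auto
    then show ?thesis by (subst (asm) sum.insert) auto
  qed
  ultimately show ?thesis using assms by (auto simp: power_0_left)
qed

text \<open>The law \<open>D\<close> of a sequence \<open>c\<^sub>0, c\<^sub>1, \<dots>\<close> of nonnegative weights whose sum has the tail \<open>G\<close>.\<close>

locale weight_law = prob_space D + regular_tail G \<alpha> b
  for D :: "'b measure" and c :: "nat \<Rightarrow> 'b \<Rightarrow> real" and G :: "real \<Rightarrow> real" and \<alpha> b :: real +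
  assumes c_meas [measurable]: "\<And>j. c j \<in> borel_measurable D"
    and c_nonneg: "\<And>j \<omega>. 0 \<le> c j \<omega>"
    and G_eq: "\<And>x. 0 \<le> x \<Longrightarrow> emeasure D {\<omega> \<in> space D. (\<Sum>j. ennreal (c j \<omega>)) > ennreal x} = ennreal (G x)"
    and moment_1: "(\<integral>\<^sup>+\<omega>. (\<Sum>j. ennreal (c j \<omega>)) \<partial>D) < \<infinity>"
    and moment_b: "(\<integral>\<^sup>+\<omega>. (\<Sum>j. ennreal (c j \<omega> powr b)) \<partial>D) < \<infinity>"
begin

definition Z :: "'b \<Rightarrow> ennreal" where "Z \<omega> = (\<Sum>j. ennreal (c j \<omega>))"

lemma Z_measurable [measurable]: "Z \<in> borel_measurable D" unfolding Z_def by measurable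

text \<open>Since \<open>p > b\<close>, the truncated \<open>p\<close>-th moment at level \<open>x\<close> of a variable with tail \<open>G\<close> is of the order
  of \<open>G x\<close>. With the scale \<open>r\<close> inside, the Potter bound even yields a factor \<open>r\<close>: the exponents \<open>1\<close>
  and \<open>b\<close> in it are at least 1 and \<open>r \<le> 1\<close>. For \<open>r = \<eta>\<^sup>n\<close> this is the required decay in \<open>n\<close>.\<close>

lemma truncated_moment:
  assumes p: "b < real p" and \<kappa>: "0 < \<kappa>"
  obtains B where "0 \<le> B" "\<And>r x. 0 < r \<Longrightarrow> r \<le> 1 \<Longrightarrow> 1 \<le> x \<Longrightarrow>
    (\<integral>\<^sup>+\<omega>. min 1 (ennreal (\<kappa> * r / x) * Z \<omega>) ^ p \<partial>D) \<le> ennreal (B * r * G x)"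
proof -
  obtain A where A: "A \<ge> 1" "\<And>c x. 0 < c \<Longrightarrow> 1 \<le> x \<Longrightarrow> G (x / c) \<le> A * (c + c powr b) * G x"
    using potter by blast
  define q where "q = 2 powr b / 2 ^ p"
  have q: "0 < q" "q < 1"
    unfolding q_def using p by (auto simp: powr_realpow[symmetric])
  have p0: "0 < p" using p b_gt \<alpha>_gt1 by (cases p) auto
  define B where "B = A * (2 * \<kappa> + (2 * \<kappa>) powr b) / (1 - q)"
  show thesis
  proof (rule that[of B])
    show "0 \<le> B" unfolding B_def using A q \<kappa> by auto
    fix r x :: real assume r: "0 < r" "r \<le> 1" and x: "1 \<le> x"
    define d where "d k = 2 * \<kappa> * r * 2 ^ k" for k :: nat
    have d: "0 < d k" for k unfolding d_def using \<kappa> r by simp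
    have iff: "ennreal (\<kappa> * r / x) * Z \<omega> > ennreal (1 / 2 ^ Suc k) \<longleftrightarrow> Z \<omega> > ennreal (x / d k)" for \<omega> k
    proof (cases "Z \<omega>")
      case (real z)
      have "1 / 2 ^ Suc k < \<kappa> * r / x * z \<longleftrightarrow> x / d k < z"
        unfolding d_def using \<kappa> r x by (simp add: field_simps)
      then show ?thesis using real \<kappa> r x d[of k] by (simp add: ennreal_mult[symmetric] ennreal_less_iff)
    qed (use \<kappa> r x in \<open>auto simp: ennreal_mult_top\<close>)
    have "(\<integral>\<^sup>+\<omega>. min 1 (ennreal (\<kappa> * r / x) * Z \<omega>) ^ p \<partial>D)
      \<le> (\<integral>\<^sup>+\<omega>. (\<Sum>k. ennreal (1 / (2 ^ k) ^ p) * indicator {\<omega> \<in> space D. Z \<omega> > ennreal (x / d k)} \<omega>) \<partial>D)"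
    proof (rule nn_integral_mono)
      fix \<omega> assume "\<omega> \<in> space D"
      then have "indicator {u. u > ennreal (1 / 2 ^ Suc k)} (ennreal (\<kappa> * r / x) * Z \<omega>)
         = (indicator {\<omega> \<in> space D. Z \<omega> > ennreal (x / d k)} \<omega> :: ennreal)" for k
        using iff[of k \<omega>] by (simp add: indicator_def)
      then show "min 1 (ennreal (\<kappa> * r / x) * Z \<omega>) ^ p
        \<le> (\<Sum>k. ennreal (1 / (2 ^ k) ^ p) * indicator {\<omega> \<in> space D. Z \<omega> > ennreal (x / d k)} \<omega>)"
        using min_power_le_dyadic[OF p0, of "ennreal (\<kappa> * r / x) * Z \<omega>"] by simp
    qed
    also have "\<dots> = (\<Sum>k. ennreal (1 / (2 ^ k) ^ p) * emeasure D {\<omega> \<in> space D. Z \<omega> > ennreal (x / d k)})"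
      by (simp add: nn_integral_suminf nn_integral_cmult)
    also have "\<dots> \<le> (\<Sum>k. ennreal (A * (2 * \<kappa> + (2 * \<kappa>) powr b) * r * G x * q ^ k))"
    proof (intro suminf_le)
      fix k
      have rb: "r powr b \<le> r" using powr_mono'[of 1 b r] r b_gt \<alpha>_gt1 by simp
      have "2 powr 1 \<le> (2::real) powr b" using b_gt \<alpha>_gt1 by (intro powr_mono) auto
      then have two: "(2::real) ^ k \<le> (2 powr b) ^ k" by (intro power_mono) auto
      have "d k powr b = (2 * \<kappa>) powr b * r powr b * (2 powr b) ^ k"
        unfolding d_def using \<kappa> r by (simp add: powr_mult powr_power powr_realpow[symmetric] powr_powr mult.commute)
      also have "\<dots> \<le> (2 * \<kappa>) powr b * r * (2 powr b) ^ k"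
        by (intro mult_right_mono mult_left_mono rb) auto
      finally have "d k + d k powr b \<le> 2 * \<kappa> * r * (2 powr b) ^ k + (2 * \<kappa>) powr b * r * (2 powr b) ^ k"
        unfolding d_def using two \<kappa> r by (intro add_mono mult_left_mono) auto
      then have dk: "d k + d k powr b \<le> (2 * \<kappa> + (2 * \<kappa>) powr b) * r * (2 powr b) ^ k"
        by (simp add: algebra_simps)
      have "ennreal (1 / (2 ^ k) ^ p) * emeasure D {\<omega> \<in> space D. Z \<omega> > ennreal (x / d k)}
         = ennreal (1 / (2 ^ k) ^ p * G (x / d k))"
        unfolding Z_def using x d[of k] less_imp_le[OF G_pos] by (subst G_eq) (auto simp: ennreal_mult[symmetric])
      also have "\<dots> \<le> ennreal (1 / (2 ^ k) ^ p * (A * ((2 * \<kappa> + (2 * \<kappa>) powr b) * r * (2 powr b) ^ k) * G x))"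
      proof (intro ennreal_leI mult_left_mono)
        have "G (x / d k) \<le> A * (d k + d k powr b) * G x" by (rule A(2)[OF d x])
        also have "\<dots> \<le> A * ((2 * \<kappa> + (2 * \<kappa>) powr b) * r * (2 powr b) ^ k) * G x"
          using A(1) less_imp_le[OF G_pos] by (intro mult_right_mono mult_left_mono dk) auto
        finally show "G (x / d k) \<le> A * ((2 * \<kappa> + (2 * \<kappa>) powr b) * r * (2 powr b) ^ k) * G x" .
      qed simp
      also have "1 / (2 ^ k) ^ p * (A * ((2 * \<kappa> + (2 * \<kappa>) powr b) * r * (2 powr b) ^ k) * G x)
        = A * (2 * \<kappa> + (2 * \<kappa>) powr b) * r * G x * q ^ k"
        unfolding q_def power_divide by (simp add: power_mult[symmetric] mult.commute[of k p])
      finally show "ennreal (1 / (2 ^ k) ^ p) * emeasure D {\<omega> \<in> space D. Z \<omega> > ennreal (x / d k)}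
        \<le> ennreal (A * (2 * \<kappa> + (2 * \<kappa>) powr b) * r * G x * q ^ k)" .
    qed auto
    also have "\<dots> = ennreal (A * (2 * \<kappa> + (2 * \<kappa>) powr b) * r * G x * (1 / (1 - q)))"
    proof (rule suminf_ennreal_eq)
      show "(\<lambda>k. A * (2 * \<kappa> + (2 * \<kappa>) powr b) * r * G x * q ^ k) sums (A * (2 * \<kappa> + (2 * \<kappa>) powr b) * r * G x * (1 / (1 - q)))"
        using q by (intro sums_mult geometric_sums) auto
    qed (use A \<kappa> r q less_imp_le[OF G_pos[of x]] in auto)
    also have "\<dots> = ennreal (B * r * G x)" unfolding B_def by simp
    finally show "(\<integral>\<^sup>+\<omega>. min 1 (ennreal (\<kappa> * r / x) * Z \<omega>) ^ p \<partial>D) \<le> ennreal (B * r * G x)" .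
  qed
qed

lemma moment_1_b: "(\<integral>\<^sup>+\<omega>. (\<Sum>j. ennreal (c j \<omega> + c j \<omega> powr b)) \<partial>D) < \<infinity>"
proof -
  have "(\<integral>\<^sup>+\<omega>. (\<Sum>j. ennreal (c j \<omega> + c j \<omega> powr b)) \<partial>D)
    = (\<integral>\<^sup>+\<omega>. (\<Sum>j. ennreal (c j \<omega>)) + (\<Sum>j. ennreal (c j \<omega> powr b)) \<partial>D)"
    by (simp add: c_nonneg suminf_add[symmetric])
  also have "\<dots> = (\<integral>\<^sup>+\<omega>. (\<Sum>j. ennreal (c j \<omega>)) \<partial>D) + (\<integral>\<^sup>+\<omega>. (\<Sum>j. ennreal (c j \<omega> powr b)) \<partial>D)"
    by (intro nn_integral_add) auto
  finally show ?thesis using moment_1 moment_b by simp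
qed

text \<open>Dominated convergence on the product of \<open>D\<close> with the counting measure, along a real parameter.\<close>

lemma dominated_weights:
  fixes h :: "real \<Rightarrow> nat \<Rightarrow> 'b \<Rightarrow> ennreal"
  assumes meas [measurable]: "\<And>y j. h y j \<in> borel_measurable D" "\<And>j. l j \<in> borel_measurable D"
    and bound: "\<And>y j \<omega>. 1 \<le> y \<Longrightarrow> h y j \<omega> \<le> ennreal (A * (c j \<omega> + c j \<omega> powr b))" and A: "0 \<le> A"
    and lim: "AE \<omega> in D. \<forall>j. ((\<lambda>y. h y j \<omega>) \<longlongrightarrow> l j \<omega>) at_top"
  shows "((\<lambda>y. \<integral>\<^sup>+\<omega>. (\<Sum>j. h y j \<omega>) \<partial>D) \<longlongrightarrow> (\<integral>\<^sup>+\<omega>. (\<Sum>j. l j \<omega>) \<partial>D)) at_top"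
proof -
  let ?P = "D \<Otimes>\<^sub>M count_space (UNIV :: nat set)"
  interpret cs: sigma_finite_measure "count_space (UNIV :: nat set)"
    by (rule sigma_finite_measure_count_space)
  interpret pair_sigma_finite D "count_space (UNIV :: nat set)" ..
  have pm [measurable]: "(\<lambda>z. f (snd z) (fst z)) \<in> borel_measurable ?P"
    if [measurable]: "\<And>j. f j \<in> borel_measurable D" for f :: "nat \<Rightarrow> 'b \<Rightarrow> ennreal"
    by (rule measurable_compose_countable[where g = snd]) measurable
  have eq: "(\<integral>\<^sup>+\<omega>. (\<Sum>j. f j \<omega>) \<partial>D) = (\<integral>\<^sup>+z. f (snd z) (fst z) \<partial>?P)"
    if [measurable]: "\<And>j. f j \<in> borel_measurable D" for f :: "nat \<Rightarrow> 'b \<Rightarrow> ennreal"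
    using cs.nn_integral_fst[OF pm[OF that]] by (simp add: nn_integral_count_space_nat)
  show ?thesis
  proof (rule tendsto_at_topI_sequentially)
    fix X :: "nat \<Rightarrow> real" assume X: "filterlim X at_top sequentially"
    \<comment> \<open>the domination only holds for parameters that are at least 1\<close>
    define Y where "Y n = max 1 (X n)" for n
    have ev: "\<forall>\<^sub>F n in sequentially. Y n = X n"
      using X unfolding Y_def filterlim_at_top by (auto simp: max_def elim!: eventually_mono)
    have Y: "filterlim Y at_top sequentially"
      using X ev by (simp add: filterlim_cong[OF refl refl ev])
    have "(\<lambda>n. \<integral>\<^sup>+z. h (Y n) (snd z) (fst z) \<partial>?P) \<longlonglongrightarrow> (\<integral>\<^sup>+z. l (snd z) (fst z) \<partial>?P)"
    proof (rule nn_integral_dominated_convergence)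
      let ?w = "\<lambda>z. ennreal (A * (c (snd z) (fst z) + c (snd z) (fst z) powr b))"
      show "?w \<in> borel_measurable ?P" by (rule pm) measurable
      show "AE z in ?P. h (Y n) (snd z) (fst z) \<le> ?w z" for n
        using bound[of "Y n"] unfolding Y_def by auto
      have "(\<integral>\<^sup>+z. ?w z \<partial>?P) = (\<integral>\<^sup>+\<omega>. (\<Sum>j. ennreal (A * (c j \<omega> + c j \<omega> powr b))) \<partial>D)"
        by (rule eq[symmetric]) measurable
      also have "\<dots> = ennreal A * (\<integral>\<^sup>+\<omega>. (\<Sum>j. ennreal (c j \<omega> + c j \<omega> powr b)) \<partial>D)"
        using A by (simp add: ennreal_mult c_nonneg nn_integral_cmult)
      finally show "(\<integral>\<^sup>+z. ?w z \<partial>?P) < \<infinity>" using moment_1_b by (simp add: ennreal_mult_less_top)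
      have "AE \<omega> in D. \<forall>j. (\<lambda>n. h (Y n) j \<omega>) \<longlonglongrightarrow> l j \<omega>"
        using lim by eventually_elim (auto intro: filterlim_compose[OF _ Y])
      then obtain S where S: "S \<in> null_sets D"
        "{\<omega> \<in> space D. \<not> (\<forall>j. (\<lambda>n. h (Y n) j \<omega>) \<longlonglongrightarrow> l j \<omega>)} \<subseteq> S"
        by (auto simp: eventually_ae_filter)
      have [measurable]: "S \<in> sets D" using S by auto
      have "AE \<omega> in D. \<omega> \<notin> S" using S(1) by (rule AE_not_in)
      then have "AE z in ?P. fst z \<notin> S" by (intro AE_pair_measure) auto
      then show "AE z in ?P. (\<lambda>n. h (Y n) (snd z) (fst z)) \<longlonglongrightarrow> l (snd z) (fst z)"
        using AE_space by eventually_elim (use S(2) in \<open>force simp: space_pair_measure\<close>)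
    qed (auto intro!: pm)
    then have "(\<lambda>n. \<integral>\<^sup>+\<omega>. (\<Sum>j. h (Y n) j \<omega>) \<partial>D) \<longlonglongrightarrow> (\<integral>\<^sup>+\<omega>. (\<Sum>j. l j \<omega>) \<partial>D)"
      by (simp add: eq)
    moreover have "\<forall>\<^sub>F n in sequentially. (\<integral>\<^sup>+\<omega>. (\<Sum>j. h (Y n) j \<omega>) \<partial>D) = (\<integral>\<^sup>+\<omega>. (\<Sum>j. h (X n) j \<omega>) \<partial>D)"
      using ev by eventually_elim simp
    ultimately show "(\<lambda>n. \<integral>\<^sup>+\<omega>. (\<Sum>j. h (X n) j \<omega>) \<partial>D) \<longlonglongrightarrow> (\<integral>\<^sup>+\<omega>. (\<Sum>j. l j \<omega>) \<partial>D)"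
      by (rule Lim_transform_eventually)
  qed
qed

lemma Z_finite: "AE \<omega> in D. Z \<omega> < \<infinity>"
proof -
  have "AE \<omega> in D. Z \<omega> \<noteq> \<infinity>"
    using moment_1 unfolding Z_def[symmetric] by (intro nn_integral_noteq_infinite) auto
  then show ?thesis by eventually_elim (simp add: less_top)
qed

text \<open>The probability that \<open>u Y\<close> exceeds \<open>y\<close>, relative to \<open>G y\<close>, when \<open>Y\<close> has tail \<open>G\<close>.\<close>

definition tail_ratio :: "real \<Rightarrow> real \<Rightarrow> real" where
  "tail_ratio y u = (if 0 < u then G (y / u) / G y else 0)"

lemma tail_ratio_measurable [measurable]: "tail_ratio y \<in> borel_measurable borel"
  unfolding tail_ratio_def by measurable

lemma tail_ratio_nonneg: "0 \<le> tail_ratio y u"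
  unfolding tail_ratio_def using less_imp_le[OF G_pos] by simp

lemma tail_ratio_limit: "0 \<le> u \<Longrightarrow> ((\<lambda>y. tail_ratio y u) \<longlongrightarrow> u powr \<alpha>) at_top"
proof (cases "u = 0")
  case False
  assume "0 \<le> u"
  with False have u: "0 < u" by simp
  have "((\<lambda>y. G (1 / u * y) / G y) \<longlongrightarrow> (1 / u) powr (- \<alpha>)) at_top"
    using u by (intro G_ratio) simp
  moreover have "(1 / u) powr (- \<alpha>) = u powr \<alpha>" using u by (simp add: powr_minus powr_divide)
  ultimately show ?thesis unfolding tail_ratio_def using u by simp
qed (simp add: tail_ratio_def)

text \<open>This is where \<open>\<rho>\<^sub>\<alpha>\<close> enters: regular variation turns \<open>G (y / c) / G y\<close> into \<open>c\<^sup>\<alpha>\<close>, and the Potter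
  bound dominates.\<close>

lemma tail_ratio_sum_limit:
  "((\<lambda>y. \<integral>\<^sup>+\<omega>. (\<Sum>j. ennreal (tail_ratio y (c j \<omega>))) \<partial>D)
     \<longlongrightarrow> (\<integral>\<^sup>+\<omega>. (\<Sum>j. ennreal (c j \<omega> powr \<alpha>)) \<partial>D)) at_top"
proof -
  obtain A where A: "A \<ge> 1" "\<And>c x. 0 < c \<Longrightarrow> 1 \<le> x \<Longrightarrow> G (x / c) \<le> A * (c + c powr b) * G x"
    using potter by blast
  show ?thesis
  proof (rule dominated_weights[where A = A])
    fix y :: real and j \<omega> assume y: "1 \<le> y"
    have "tail_ratio y (c j \<omega>) \<le> A * (c j \<omega> + c j \<omega> powr b)"
      using A(2)[of "c j \<omega>" y] y A(1) G_pos[of y] c_nonneg[of j \<omega>]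
      unfolding tail_ratio_def by (auto simp: field_simps)
    then show "ennreal (tail_ratio y (c j \<omega>)) \<le> ennreal (A * (c j \<omega> + c j \<omega> powr b))"
      by (rule ennreal_leI)
  next
    show "AE \<omega> in D. \<forall>j. ((\<lambda>y. ennreal (tail_ratio y (c j \<omega>))) \<longlongrightarrow> ennreal (c j \<omega> powr \<alpha>)) at_top"
      by (intro AE_I2 allI tendsto_ennrealI tail_ratio_limit c_nonneg)
  qed (use A in auto)
qed

text \<open>Two large contributions to one sum are asymptotically negligible, since \<open>Z\<close> is almost surely finite.\<close>

lemma two_jumps_limit:
  assumes \<kappa>: "0 \<le> \<kappa>"
  shows "((\<lambda>x. \<integral>\<^sup>+\<omega>. (\<Sum>j. ennreal (c j \<omega> + c j \<omega> powr b)) * min 1 (ennreal (\<kappa> / x) * Z \<omega>) \<partial>D) \<longlongrightarrow> 0) at_top"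
proof -
  have "((\<lambda>x. \<integral>\<^sup>+\<omega>. (\<Sum>j. ennreal (c j \<omega> + c j \<omega> powr b) * min 1 (ennreal (\<kappa> / x) * Z \<omega>)) \<partial>D)
    \<longlongrightarrow> (\<integral>\<^sup>+\<omega>. (\<Sum>j. 0) \<partial>D)) at_top"
  proof (rule dominated_weights[where A = 1])
    fix y j \<omega>
    have "ennreal (c j \<omega> + c j \<omega> powr b) * min 1 (ennreal (\<kappa> / y) * Z \<omega>) \<le> ennreal (c j \<omega> + c j \<omega> powr b) * 1"
      by (intro mult_left_mono) auto
    then show "ennreal (c j \<omega> + c j \<omega> powr b) * min 1 (ennreal (\<kappa> / y) * Z \<omega>) \<le> ennreal (1 * (c j \<omega> + c j \<omega> powr b))"
      by simp
  next
    show "AE \<omega> in D. \<forall>j. ((\<lambda>x. ennreal (c j \<omega> + c j \<omega> powr b) * min 1 (ennreal (\<kappa> / x) * Z \<omega>)) \<longlongrightarrow> 0) at_top"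
      using Z_finite
    proof eventually_elim
      case (elim \<omega>)
      then obtain z where z: "Z \<omega> = ennreal z" "0 \<le> z" by (cases "Z \<omega>") auto
      have "((\<lambda>x. \<kappa> * z / x) \<longlongrightarrow> 0) at_top"
        by (intro tendsto_divide_0[OF tendsto_const] filterlim_at_top_imp_at_infinity filterlim_ident)
      then have "((\<lambda>x. ennreal ((c j \<omega> + c j \<omega> powr b) * (\<kappa> * z / x))) \<longlongrightarrow> ennreal ((c j \<omega> + c j \<omega> powr b) * 0)) at_top" for j
        by (intro tendsto_ennrealI tendsto_mult tendsto_const)
      then have lim: "((\<lambda>x. ennreal ((c j \<omega> + c j \<omega> powr b) * (\<kappa> * z / x))) \<longlongrightarrow> 0) at_top" for j
        by simp
      show ?case
      proof
        fix j
        show "((\<lambda>x. ennreal (c j \<omega> + c j \<omega> powr b) * min 1 (ennreal (\<kappa> / x) * Z \<omega>)) \<longlongrightarrow> 0) at_top"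
        proof (rule tendsto_sandwich[OF _ _ tendsto_const lim[of j]])
          show "\<forall>\<^sub>F x in at_top. ennreal (c j \<omega> + c j \<omega> powr b) * min 1 (ennreal (\<kappa> / x) * Z \<omega>)
              \<le> ennreal ((c j \<omega> + c j \<omega> powr b) * (\<kappa> * z / x))"
            using eventually_gt_at_top[of 0]
          proof eventually_elim
            case (elim x)
            have "ennreal (c j \<omega> + c j \<omega> powr b) * min 1 (ennreal (\<kappa> / x) * Z \<omega>)
              \<le> ennreal (c j \<omega> + c j \<omega> powr b) * (ennreal (\<kappa> / x) * Z \<omega>)"
              by (intro mult_left_mono) auto
            also have "\<dots> = ennreal ((c j \<omega> + c j \<omega> powr b) * (\<kappa> * z / x))"
              using \<kappa> elim z c_nonneg[of j \<omega>] by (simp add: ennreal_mult[symmetric] del: ennreal_plus)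
            finally show ?case .
          qed
        qed auto
      qed
    qed
  qed auto
  then show ?thesis by simp
qed

end

section \<open>The tail bound for one generation, averaged over the weights\<close>

lemma ennreal_mult_add_mult:
  "0 \<le> a \<Longrightarrow> 0 \<le> b \<Longrightarrow> 0 \<le> c \<Longrightarrow> 0 \<le> d \<Longrightarrow>
    ennreal a * ennreal b + ennreal c * ennreal d = ennreal (a * b + c * d)"
  by (simp add: ennreal_mult)

lemma finite_ennrealE:
  assumes "(x :: ennreal) < \<infinity>"
  obtains r where "x = ennreal r" "0 \<le> r"
  using assms by (cases x) auto

context weight_law
begin

text \<open>A bound for the probability that \<open>u Y\<close> exceeds \<open>y\<close>, for \<open>Y\<close> of mean at most \<open>m r\<close> and with tail at
  most \<open>K r G\<close> on \<open>[1, \<infinity>)\<close>. The first term is the tail bound; the second one is a Markov bound, which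
  covers the case \<open>u > y\<close>, where \<open>y / u\<close> leaves that range. Keeping the two terms apart matters,
  since only the first one contains the constant \<open>K\<close> of the induction.\<close>

definition tail_bound :: "real \<Rightarrow> real \<Rightarrow> real \<Rightarrow> real \<Rightarrow> real \<Rightarrow> real" where
  "tail_bound K m r y u = (if 0 < u then r * (K * G (y / u) + m * (u / y) powr b) else 0)"

lemma tail_bound_measurable [measurable]: "tail_bound K m r y \<in> borel_measurable borel"
  unfolding tail_bound_def by measurable

lemma tail_bound_eq:
  assumes "0 \<le> u" "0 < y"
  shows "tail_bound K m r y u = r * K * G y * tail_ratio y u + r * m * y powr (- b) * u powr b"
  using assms G_pos[of y]
  by (auto simp: tail_bound_def tail_ratio_def powr_divide powr_minus field_simps)

text \<open>The coefficient of \<open>K\<close> is asymptotically \<open>\<rho>\<^sub>\<alpha>\<close>, whereas the Markov part only contributes to \<open>B\<close>.\<close>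

lemma one_jump_integral:
  assumes \<rho>: "(\<integral>\<^sup>+\<omega>. (\<Sum>j. ennreal (c j \<omega> powr \<alpha>)) \<partial>D) < ennreal \<theta>" and m: "0 \<le> m"
  obtains B y0 where "0 \<le> B" "1 \<le> y0" "\<And>K r y. 0 \<le> K \<Longrightarrow> 0 \<le> r \<Longrightarrow> y0 \<le> y \<Longrightarrow>
    (\<integral>\<^sup>+\<omega>. (\<Sum>j. ennreal (tail_bound K m r y (c j \<omega>))) \<partial>D) \<le> ennreal ((\<theta> * K + B) * r * G y)"
proof -
  obtain B1 where B1: "B1 > 0" "\<And>x. 1 \<le> x \<Longrightarrow> x powr (- b) \<le> B1 * G x"
    using power_lower_bound by blast
  obtain mb where mb: "(\<integral>\<^sup>+\<omega>. (\<Sum>j. ennreal (c j \<omega> powr b)) \<partial>D) = ennreal mb" "0 \<le> mb"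
    by (rule finite_ennrealE[OF moment_b])
  have \<theta>: "0 < \<theta>" using \<rho> by (metis ennreal_neg not_less not_less_zero)
  have "\<forall>\<^sub>F y in at_top. (\<integral>\<^sup>+\<omega>. (\<Sum>j. ennreal (tail_ratio y (c j \<omega>))) \<partial>D) < ennreal \<theta>"
    using order_tendstoD(2)[OF tail_ratio_sum_limit \<rho>] .
  then obtain y1 where y1: "\<And>y. y1 \<le> y \<Longrightarrow> (\<integral>\<^sup>+\<omega>. (\<Sum>j. ennreal (tail_ratio y (c j \<omega>))) \<partial>D) < ennreal \<theta>"
    by (auto simp: eventually_at_top_linorder)
  show thesis
  proof (rule that[of "m * B1 * mb" "max 1 y1"])
    show "0 \<le> m * B1 * mb" using m B1(1) mb by simp
    fix K r y :: real assume K: "0 \<le> K" and r: "0 \<le> r" and y: "max 1 y1 \<le> y"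
    have "(\<integral>\<^sup>+\<omega>. (\<Sum>j. ennreal (tail_bound K m r y (c j \<omega>))) \<partial>D)
      = (\<integral>\<^sup>+\<omega>. ennreal (r * K * G y) * (\<Sum>j. ennreal (tail_ratio y (c j \<omega>)))
          + ennreal (r * m * y powr (- b)) * (\<Sum>j. ennreal (c j \<omega> powr b)) \<partial>D)"
    proof (rule nn_integral_cong)
      fix \<omega>
      have "ennreal (tail_bound K m r y (c j \<omega>)) = ennreal (r * K * G y) * ennreal (tail_ratio y (c j \<omega>))
          + ennreal (r * m * y powr (- b)) * ennreal (c j \<omega> powr b)" for j
        using K r y m less_imp_le[OF G_pos[of y]] tail_ratio_nonneg[of y "c j \<omega>"] c_nonneg[of j \<omega>]
        by (subst ennreal_mult_add_mult) (auto simp: tail_bound_eq)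
      then show "(\<Sum>j. ennreal (tail_bound K m r y (c j \<omega>))) = ennreal (r * K * G y) * (\<Sum>j. ennreal (tail_ratio y (c j \<omega>)))
          + ennreal (r * m * y powr (- b)) * (\<Sum>j. ennreal (c j \<omega> powr b))"
        by (simp add: suminf_add[symmetric])
    qed
    also have "\<dots> = ennreal (r * K * G y) * (\<integral>\<^sup>+\<omega>. (\<Sum>j. ennreal (tail_ratio y (c j \<omega>))) \<partial>D)
      + ennreal (r * m * y powr (- b)) * ennreal mb"
      by (simp add: nn_integral_add nn_integral_cmult mb(1))
    also have "\<dots> \<le> ennreal (r * K * G y) * ennreal \<theta> + ennreal (r * m * (B1 * G y)) * ennreal mb"
      using y r m by (intro add_mono mult_right_mono mult_left_mono less_imp_le[OF y1] ennreal_leI B1) auto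
    also have "\<dots> = ennreal ((\<theta> * K + m * B1 * mb) * r * G y)"
    proof -
      have "r * K * G y * \<theta> + r * m * (B1 * G y) * mb = (\<theta> * K + m * B1 * mb) * r * G y"
        by (simp add: algebra_simps)
      then show ?thesis
        using K r m less_imp_le[OF G_pos[of y]] B1(1) mb \<theta>
        by (subst ennreal_mult_add_mult) auto
    qed
    finally show "(\<integral>\<^sup>+\<omega>. (\<Sum>j. ennreal (tail_bound K m r y (c j \<omega>))) \<partial>D) \<le> ennreal ((\<theta> * K + m * B1 * mb) * r * G y)" .
  qed simp
qed

text \<open>The coefficient \<open>\<zeta>\<close> of \<open>K\<close> can be made arbitrarily small here, at the price of a large \<open>x0\<close>.\<close>

lemma two_jumps_integral:
  assumes \<zeta>: "0 < \<zeta>" and m: "0 \<le> m" and s: "1 \<le> s" and \<kappa>: "0 \<le> \<kappa>"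
  obtains B x0 where "0 \<le> B" "1 \<le> x0" "\<And>K r x. 0 \<le> K \<Longrightarrow> 0 \<le> r \<Longrightarrow> r \<le> 1 \<Longrightarrow> x0 \<le> x \<Longrightarrow>
    (\<integral>\<^sup>+\<omega>. (\<Sum>j. ennreal (tail_bound K m r (x / s) (c j \<omega>))) * min 1 (ennreal (\<kappa> * r / x) * Z \<omega>) \<partial>D)
      \<le> ennreal ((\<zeta> * K + B) * r * G x)"
proof -
  obtain A where A: "A \<ge> 1" "\<And>c x. 0 < c \<Longrightarrow> 1 \<le> x \<Longrightarrow> G (x / c) \<le> A * (c + c powr b) * G x"
    using potter by blast
  obtain B1 where B1: "B1 > 0" "\<And>x. 1 \<le> x \<Longrightarrow> x powr (- b) \<le> B1 * G x"
    using power_lower_bound by blast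
  obtain mb where mb: "(\<integral>\<^sup>+\<omega>. (\<Sum>j. ennreal (c j \<omega> powr b)) \<partial>D) = ennreal mb" "0 \<le> mb"
    by (rule finite_ennrealE[OF moment_b])
  define As where "As = A * (s + s powr b)"
  have As: "0 < As" unfolding As_def using A(1) s by (intro mult_pos_pos add_pos_nonneg) auto
  define \<xi> where "\<xi> = \<zeta> / (A * As)"
  have \<xi>: "0 < \<xi>" unfolding \<xi>_def using \<zeta> A(1) As by simp
  let ?S = "\<lambda>x \<omega>. (\<Sum>j. ennreal (c j \<omega> + c j \<omega> powr b)) * min 1 (ennreal (\<kappa> / x) * Z \<omega>)"
  have "\<forall>\<^sub>F x in at_top. (\<integral>\<^sup>+\<omega>. ?S x \<omega> \<partial>D) < ennreal \<xi>"
    using order_tendstoD(2)[OF two_jumps_limit[OF \<kappa>], of "ennreal \<xi>"] \<xi> by simp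
  then obtain x1 where x1: "\<And>x. x1 \<le> x \<Longrightarrow> (\<integral>\<^sup>+\<omega>. ?S x \<omega> \<partial>D) < ennreal \<xi>"
    by (auto simp: eventually_at_top_linorder)
  show thesis
  proof (rule that[of "m * B1 * As * mb" "max s x1"])
    show "0 \<le> m * B1 * As * mb" using m B1(1) mb As by simp
    show "1 \<le> max s x1" using s by simp
    fix K r x :: real assume K: "0 \<le> K" and r: "0 \<le> r" "r \<le> 1" and x: "max s x1 \<le> x"
    define y where "y = x / s"
    have y: "1 \<le> y" unfolding y_def using x s by simp
    have x0: "1 \<le> x" using x s by simp
    have Gy: "G y \<le> As * G x" unfolding y_def As_def using A(2)[of s x] s x0 by simp
    have Gx: "0 \<le> G x" "0 \<le> G y" using less_imp_le[OF G_pos] by auto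
    have "(\<integral>\<^sup>+\<omega>. (\<Sum>j. ennreal (tail_bound K m r y (c j \<omega>))) * min 1 (ennreal (\<kappa> * r / x) * Z \<omega>) \<partial>D)
      \<le> (\<integral>\<^sup>+\<omega>. ennreal (r * K * A * G y) * ?S x \<omega>
          + ennreal (r * m * y powr (- b)) * (\<Sum>j. ennreal (c j \<omega> powr b)) \<partial>D)"
    proof (rule nn_integral_mono)
      fix \<omega>
      let ?q = "min 1 (ennreal (\<kappa> * r / x) * Z \<omega>)"
      have tb: "ennreal (tail_bound K m r y (c j \<omega>)) \<le> ennreal (r * K * A * G y) * ennreal (c j \<omega> + c j \<omega> powr b)
          + ennreal (r * m * y powr (- b)) * ennreal (c j \<omega> powr b)" for j
      proof -
        have "tail_ratio y (c j \<omega>) \<le> A * (c j \<omega> + c j \<omega> powr b)"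
          using A(2)[of "c j \<omega>" y] y A(1) G_pos[of y] c_nonneg[of j \<omega>]
          unfolding tail_ratio_def by (auto simp: field_simps)
        then have "r * K * G y * tail_ratio y (c j \<omega>) \<le> r * K * G y * (A * (c j \<omega> + c j \<omega> powr b))"
          using K r Gx by (intro mult_left_mono) auto
        then have "tail_bound K m r y (c j \<omega>) \<le> r * K * A * G y * (c j \<omega> + c j \<omega> powr b) + r * m * y powr (- b) * c j \<omega> powr b"
          using y c_nonneg[of j \<omega>] by (simp add: tail_bound_eq mult_ac)
        then show ?thesis
          using K r m Gx A(1) c_nonneg[of j \<omega>]
          by (subst ennreal_mult_add_mult) (auto intro!: ennreal_leI simp del: ennreal_plus)
      qed
      have "(\<Sum>j. ennreal (tail_bound K m r y (c j \<omega>))) * ?q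
        \<le> (\<Sum>j. ennreal (r * K * A * G y) * ennreal (c j \<omega> + c j \<omega> powr b)
          + ennreal (r * m * y powr (- b)) * ennreal (c j \<omega> powr b)) * ?q"
        by (intro mult_right_mono suminf_le tb) auto
      also have "\<dots> = (ennreal (r * K * A * G y) * (\<Sum>j. ennreal (c j \<omega> + c j \<omega> powr b))
          + ennreal (r * m * y powr (- b)) * (\<Sum>j. ennreal (c j \<omega> powr b))) * ?q"
        by (simp add: suminf_add[symmetric] del: ennreal_plus)
      also have "\<dots> = ennreal (r * K * A * G y) * ((\<Sum>j. ennreal (c j \<omega> + c j \<omega> powr b)) * ?q)
          + ennreal (r * m * y powr (- b)) * (\<Sum>j. ennreal (c j \<omega> powr b)) * ?q"
        unfolding distrib_right mult.assoc ..
      also have "\<dots> \<le> ennreal (r * K * A * G y) * ?S x \<omega>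
          + ennreal (r * m * y powr (- b)) * (\<Sum>j. ennreal (c j \<omega> powr b)) * 1"
      proof (rule add_mono)
        have "\<kappa> * r / x \<le> \<kappa> / x" using r \<kappa> x0 by (intro divide_right_mono mult_left_le) auto
        then have "ennreal (\<kappa> * r / x) * Z \<omega> \<le> ennreal (\<kappa> / x) * Z \<omega>"
          by (intro mult_right_mono ennreal_leI) auto
        then have "?q \<le> min 1 (ennreal (\<kappa> / x) * Z \<omega>)" by (rule min.mono[OF order_refl])
        then show "ennreal (r * K * A * G y) * ((\<Sum>j. ennreal (c j \<omega> + c j \<omega> powr b)) * ?q) \<le> ennreal (r * K * A * G y) * ?S x \<omega>"
          by (rule mult_left_mono[OF mult_left_mono]) auto
        show "ennreal (r * m * y powr (- b)) * (\<Sum>j. ennreal (c j \<omega> powr b)) * ?q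
          \<le> ennreal (r * m * y powr (- b)) * (\<Sum>j. ennreal (c j \<omega> powr b)) * 1"
          by (rule mult_left_mono) auto
      qed
      finally show "(\<Sum>j. ennreal (tail_bound K m r y (c j \<omega>))) * ?q \<le> ennreal (r * K * A * G y) * ?S x \<omega>
          + ennreal (r * m * y powr (- b)) * (\<Sum>j. ennreal (c j \<omega> powr b))" by simp
    qed
    also have "\<dots> = ennreal (r * K * A * G y) * (\<integral>\<^sup>+\<omega>. ?S x \<omega> \<partial>D) + ennreal (r * m * y powr (- b)) * ennreal mb"
      by (simp add: nn_integral_add nn_integral_cmult mb(1) del: ennreal_plus)
    also have "\<dots> \<le> ennreal (r * K * A * (As * G x)) * ennreal \<xi> + ennreal (r * m * (B1 * (As * G x))) * ennreal mb"
    proof (rule add_mono)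
      have 1: "(\<integral>\<^sup>+\<omega>. ?S x \<omega> \<partial>D) \<le> ennreal \<xi>" by (rule less_imp_le[OF x1]) (use x in simp)
      have "r * K * A * G y \<le> r * K * A * (As * G x)" using K r A(1) by (intro mult_left_mono Gy) auto
      then show "ennreal (r * K * A * G y) * (\<integral>\<^sup>+\<omega>. ?S x \<omega> \<partial>D) \<le> ennreal (r * K * A * (As * G x)) * ennreal \<xi>"
        by (rule mult_mono[OF ennreal_leI 1]) auto
      have "y powr (- b) \<le> B1 * G y" by (rule B1(2)[OF y])
      also have "\<dots> \<le> B1 * (As * G x)" using B1(1) by (intro mult_left_mono Gy) auto
      finally have "r * m * y powr (- b) \<le> r * m * (B1 * (As * G x))" using r(1) m by (intro mult_left_mono) auto
      then show "ennreal (r * m * y powr (- b)) * ennreal mb \<le> ennreal (r * m * (B1 * (As * G x))) * ennreal mb"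
        by (intro mult_right_mono ennreal_leI) auto
    qed
    also have "\<dots> = ennreal ((\<zeta> * K + m * B1 * As * mb) * r * G x)"
    proof -
      have AAs: "A * As * \<xi> = \<zeta>" unfolding \<xi>_def using A(1) As by (simp del: mult_eq_0_iff)
      have "r * K * A * (As * G x) * \<xi> = (A * As * \<xi>) * K * r * G x" by (simp only: mult_ac)
      then have e: "r * K * A * (As * G x) * \<xi> = \<zeta> * K * r * G x" unfolding AAs .
      have "r * K * A * (As * G x) * \<xi> + r * m * (B1 * (As * G x)) * mb = (\<zeta> * K + m * B1 * As * mb) * r * G x"
        unfolding e by (simp add: algebra_simps)
      then show ?thesis
        using K r A(1) As Gx \<xi> m B1(1) mb by (subst ennreal_mult_add_mult) auto
    qed
    finally show "(\<integral>\<^sup>+\<omega>. (\<Sum>j. ennreal (tail_bound K m r (x / s) (c j \<omega>))) * min 1 (ennreal (\<kappa> * r / x) * Z \<omega>) \<partial>D)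
      \<le> ennreal ((\<zeta> * K + m * B1 * As * mb) * r * G x)" unfolding y_def .
  qed
qed

text \<open>The three parts of the single-jump bound, averaged over the weights. A tail bound with constant \<open>K\<close>
  passes to the next generation with constant \<open>\<theta> K + B\<close>. That \<open>\<theta> < \<eta>\<close> and that \<open>B\<close> and \<open>x0\<close> depend
  neither on \<open>K\<close> nor on the scale \<open>r\<close> is what allows one constant for all generations. The
  parameters are chosen in the order \<open>\<theta>\<^sub>1\<close>, \<open>\<delta>\<close>, \<open>p\<close>, \<open>\<zeta>\<close>, \<open>x0\<close>.\<close>

lemma generation_step_integral:
  assumes \<rho>: "(\<integral>\<^sup>+\<omega>. (\<Sum>j. ennreal (c j \<omega> powr \<alpha>)) \<partial>D) < ennreal \<eta>" and m: "0 < m"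
  obtains \<theta> B x0 \<delta> and p :: nat where
    "0 \<le> \<theta>" "\<theta> < \<eta>" "0 \<le> B" "1 \<le> x0" "0 < p" "0 < \<delta>" "\<delta> < 1"
    "\<And>x. x0 \<le> x \<Longrightarrow> 1 \<le> x / real p \<and> 1 \<le> (1 - \<delta>) * x"
    "\<And>K r x. 0 \<le> K \<Longrightarrow> 0 < r \<Longrightarrow> r \<le> 1 \<Longrightarrow> x0 \<le> x \<Longrightarrow>
      (\<integral>\<^sup>+\<omega>. ennreal (exp 1) * min 1 (ennreal (m * r * real p / x) * Z \<omega>) ^ p
        + (\<Sum>j. ennreal (tail_bound K m r ((1 - \<delta>) * x) (c j \<omega>)))
        + (\<Sum>j. ennreal (tail_bound K m r (x / real p) (c j \<omega>))) * min 1 (ennreal (m * r / (\<delta> * x)) * Z \<omega>) \<partial>D)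
      \<le> ennreal ((\<theta> * K + B) * r * G x)"
proof -
  obtain \<theta>\<^sub>1 where t1: "(\<integral>\<^sup>+\<omega>. (\<Sum>j. ennreal (c j \<omega> powr \<alpha>)) \<partial>D) < ennreal \<theta>\<^sub>1" "\<theta>\<^sub>1 < \<eta>" "0 < \<theta>\<^sub>1"
  proof -
    obtain ra where ra: "(\<integral>\<^sup>+\<omega>. (\<Sum>j. ennreal (c j \<omega> powr \<alpha>)) \<partial>D) = ennreal ra" "0 \<le> ra"
      by (rule finite_ennrealE[OF less_trans[OF \<rho> ennreal_less_top, folded infinity_ennreal_def]])
    then have "ra < \<eta>" using \<rho> by (simp add: ennreal_less_iff)
    then show thesis using ra by (intro that[of "(ra + \<eta>) / 2"]) (auto simp: ennreal_less_iff)
  qed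
  \<comment> \<open>a number between 1 and \<open>\<eta> / \<theta>\<^sub>1\<close>, the room left for the loss from \<open>x\<close> to \<open>(1 - \<delta>) x\<close>\<close>
  define \<theta>\<^sub>2 where "\<theta>\<^sub>2 = (1 + \<eta> / \<theta>\<^sub>1) / 2"
  have t2: "1 < \<theta>\<^sub>2" "\<theta>\<^sub>1 * \<theta>\<^sub>2 < \<eta>" unfolding \<theta>\<^sub>2_def using t1 by (auto simp: field_simps)
  \<comment> \<open>\<open>u = 1 - \<delta>\<close> is close enough to 1 for the limit \<open>u\<^sup>-\<^sup>\<alpha> = \<theta>\<^sub>2 powr (1 / 2)\<close> of \<open>G (u x) / G x\<close> to lie below \<open>\<theta>\<^sub>2\<close>\<close>
  define u where "u = \<theta>\<^sub>2 powr (- 1 / (2 * \<alpha>))"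
  have u: "0 < u" unfolding u_def using t2 by simp
  have "\<theta>\<^sub>2 powr (- 1 / (2 * \<alpha>)) < \<theta>\<^sub>2 powr 0" using t2 \<alpha>_gt1 by (intro powr_less_mono) auto
  then have u1: "u < 1" unfolding u_def using t2 by simp
  have "u powr (- \<alpha>) = \<theta>\<^sub>2 powr (1 / 2)" unfolding u_def using \<alpha>_gt1 by (simp add: powr_powr)
  also have "\<dots> < \<theta>\<^sub>2 powr 1" using t2 by (intro powr_less_mono) auto
  finally have ua: "u powr (- \<alpha>) < \<theta>\<^sub>2" using t2 by simp
  have "\<forall>\<^sub>F x in at_top. G (u * x) / G x < \<theta>\<^sub>2" using order_tendstoD(2)[OF G_ratio[OF u] ua] .
  then obtain x1 where x1: "\<And>x. x1 \<le> x \<Longrightarrow> G (u * x) / G x < \<theta>\<^sub>2"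
    by (auto simp: eventually_at_top_linorder)
  obtain p :: nat where p: "b < real p" using reals_Archimedean2 by blast
  have p1: "1 < real p" using p b_gt \<alpha>_gt1 by linarith
  have mp: "0 < m * real p" and mu: "0 \<le> m / (1 - u)" using m p1 u1 by auto
  define \<zeta> where "\<zeta> = (\<eta> - \<theta>\<^sub>1 * \<theta>\<^sub>2) / 2"
  have z: "0 < \<zeta>" unfolding \<zeta>_def using t2 by simp
  obtain B1 where B1: "0 \<le> B1" "\<And>r x. 0 < r \<Longrightarrow> r \<le> 1 \<Longrightarrow> 1 \<le> x \<Longrightarrow>
      (\<integral>\<^sup>+\<omega>. min 1 (ennreal (m * real p * r / x) * Z \<omega>) ^ p \<partial>D) \<le> ennreal (B1 * r * G x)"
    using truncated_moment[OF p mp] by blast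
  obtain B2 y2 where B2: "0 \<le> B2" "1 \<le> y2" "\<And>K r y. 0 \<le> K \<Longrightarrow> 0 \<le> r \<Longrightarrow> y2 \<le> y \<Longrightarrow>
    (\<integral>\<^sup>+\<omega>. (\<Sum>j. ennreal (tail_bound K m r y (c j \<omega>))) \<partial>D) \<le> ennreal ((\<theta>\<^sub>1 * K + B2) * r * G y)"
    using one_jump_integral[OF t1(1) less_imp_le[OF m]] by blast
  obtain B3 x3 where B3: "0 \<le> B3" "1 \<le> x3" "\<And>K r x. 0 \<le> K \<Longrightarrow> 0 \<le> r \<Longrightarrow> r \<le> 1 \<Longrightarrow> x3 \<le> x \<Longrightarrow>
    (\<integral>\<^sup>+\<omega>. (\<Sum>j. ennreal (tail_bound K m r (x / real p) (c j \<omega>))) * min 1 (ennreal (m / (1 - u) * r / x) * Z \<omega>) \<partial>D)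
      \<le> ennreal ((\<zeta> * K + B3) * r * G x)"
    using two_jumps_integral[OF z less_imp_le[OF m] less_imp_le[OF p1] mu] by blast
  define x0 where "x0 = Max {x1, y2 / u, x3, real p, 1 / u}"
  have x0: "x1 \<le> x0" "y2 / u \<le> x0" "x3 \<le> x0" "real p \<le> x0" "1 / u \<le> x0" unfolding x0_def by auto
  show thesis
  proof (rule that[of "\<theta>\<^sub>1 * \<theta>\<^sub>2 + \<zeta>" "exp 1 * B1 + B2 * \<theta>\<^sub>2 + B3" x0 p "1 - u"])
    show "0 \<le> \<theta>\<^sub>1 * \<theta>\<^sub>2 + \<zeta>" using t1 t2 z by simp
    show "\<theta>\<^sub>1 * \<theta>\<^sub>2 + \<zeta> < \<eta>" unfolding \<zeta>_def using t2 by (simp add: field_simps)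
    show "0 \<le> exp 1 * B1 + B2 * \<theta>\<^sub>2 + B3" using B1 B2 B3 t2 by simp
    show "1 \<le> x0" using x0 B3 by linarith
    show "0 < p" "0 < 1 - u" "1 - u < 1" using p1 u u1 by auto
    show "1 \<le> x / real p \<and> 1 \<le> (1 - (1 - u)) * x" if "x0 \<le> x" for x
    proof -
      have "real p \<le> x" "1 / u \<le> x" using that x0 by linarith+
      then show ?thesis using u p1 by (simp add: field_simps)
    qed
    fix K r x :: real assume K: "0 \<le> K" and r: "0 < r" "r \<le> 1" and x: "x0 \<le> x"
    have xx: "1 \<le> x" "x1 \<le> x" "x3 \<le> x" "y2 / u \<le> x" using x0 x B3 by linarith+
    have y: "y2 \<le> u * x" using xx u by (simp add: field_simps)
    have Gx: "0 < G x" by (rule G_pos)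
    have Gu: "G (u * x) \<le> \<theta>\<^sub>2 * G x" using x1[OF xx(2)] Gx by (simp add: field_simps)
    have I1: "(\<integral>\<^sup>+\<omega>. min 1 (ennreal (m * r * real p / x) * Z \<omega>) ^ p \<partial>D) \<le> ennreal (B1 * r * G x)"
      using B1(2)[OF r xx(1)] by (simp add: mult_ac)
    have "(\<integral>\<^sup>+\<omega>. (\<Sum>j. ennreal (tail_bound K m r (u * x) (c j \<omega>))) \<partial>D) \<le> ennreal ((\<theta>\<^sub>1 * K + B2) * r * G (u * x))"
      using B2(3)[OF K _ y] r by simp
    also have "\<dots> \<le> ennreal ((\<theta>\<^sub>1 * K + B2) * r * (\<theta>\<^sub>2 * G x))"
      using K r t1 B2 by (intro ennreal_leI mult_left_mono Gu) auto
    finally have I2: "(\<integral>\<^sup>+\<omega>. (\<Sum>j. ennreal (tail_bound K m r (u * x) (c j \<omega>))) \<partial>D) \<le> ennreal ((\<theta>\<^sub>1 * K + B2) * r * (\<theta>\<^sub>2 * G x))" .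
    have I3: "(\<integral>\<^sup>+\<omega>. (\<Sum>j. ennreal (tail_bound K m r (x / real p) (c j \<omega>))) * min 1 (ennreal (m * r / ((1 - u) * x)) * Z \<omega>) \<partial>D)
      \<le> ennreal ((\<zeta> * K + B3) * r * G x)"
      using B3(3)[OF K _ r(2) xx(3)] r by simp
    have "(\<integral>\<^sup>+\<omega>. ennreal (exp 1) * min 1 (ennreal (m * r * real p / x) * Z \<omega>) ^ p
        + (\<Sum>j. ennreal (tail_bound K m r (u * x) (c j \<omega>)))
        + (\<Sum>j. ennreal (tail_bound K m r (x / real p) (c j \<omega>))) * min 1 (ennreal (m * r / ((1 - u) * x)) * Z \<omega>) \<partial>D)
      = ennreal (exp 1) * (\<integral>\<^sup>+\<omega>. min 1 (ennreal (m * r * real p / x) * Z \<omega>) ^ p \<partial>D)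
        + (\<integral>\<^sup>+\<omega>. (\<Sum>j. ennreal (tail_bound K m r (u * x) (c j \<omega>))) \<partial>D)
        + (\<integral>\<^sup>+\<omega>. (\<Sum>j. ennreal (tail_bound K m r (x / real p) (c j \<omega>))) * min 1 (ennreal (m * r / ((1 - u) * x)) * Z \<omega>) \<partial>D)"
      by (simp add: nn_integral_add nn_integral_cmult)
    also have "\<dots> \<le> ennreal (exp 1) * ennreal (B1 * r * G x) + ennreal ((\<theta>\<^sub>1 * K + B2) * r * (\<theta>\<^sub>2 * G x))
        + ennreal ((\<zeta> * K + B3) * r * G x)"
      by (intro add_mono mult_left_mono I1 I2 I3) auto
    also have "\<dots> = ennreal (((\<theta>\<^sub>1 * \<theta>\<^sub>2 + \<zeta>) * K + (exp 1 * B1 + B2 * \<theta>\<^sub>2 + B3)) * r * G x)"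
    proof -
      have "exp 1 * (B1 * r * G x) + (\<theta>\<^sub>1 * K + B2) * r * (\<theta>\<^sub>2 * G x) * 1 + (\<zeta> * K + B3) * r * G x
        = ((\<theta>\<^sub>1 * \<theta>\<^sub>2 + \<zeta>) * K + (exp 1 * B1 + B2 * \<theta>\<^sub>2 + B3)) * r * G x"
        by (simp add: algebra_simps)
      moreover have "0 \<le> (\<theta>\<^sub>1 * K + B2) * r * (\<theta>\<^sub>2 * G x)" "0 \<le> (\<zeta> * K + B3) * r * G x" "0 \<le> B1 * r * G x"
        using B1(1) B2(1) B3(1) K r z t1 t2 Gx by auto
      ultimately show ?thesis
        using ennreal_mult_add_mult[of "exp 1" "B1 * r * G x" "(\<theta>\<^sub>1 * K + B2) * r * (\<theta>\<^sub>2 * G x)" 1]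
          ennreal_plus[of "exp 1 * (B1 * r * G x) + (\<theta>\<^sub>1 * K + B2) * r * (\<theta>\<^sub>2 * G x) * 1" "(\<zeta> * K + B3) * r * G x"]
        by (simp del: ennreal_plus)
    qed
    finally show "(\<integral>\<^sup>+\<omega>. ennreal (exp 1) * min 1 (ennreal (m * r * real p / x) * Z \<omega>) ^ p
        + (\<Sum>j. ennreal (tail_bound K m r ((1 - (1 - u)) * x) (c j \<omega>)))
        + (\<Sum>j. ennreal (tail_bound K m r (x / real p) (c j \<omega>))) * min 1 (ennreal (m * r / ((1 - u) * x)) * Z \<omega>) \<partial>D)
      \<le> ennreal (((\<theta>\<^sub>1 * \<theta>\<^sub>2 + \<zeta>) * K + (exp 1 * B1 + B2 * \<theta>\<^sub>2 + B3)) * r * G x)" by simp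
  qed
qed

end

section \<open>Branches of the tree\<close>

text \<open>Fubini's theorem for two independent random elements: freeze the first one, average over the second.\<close>

lemma (in prob_space) indep_var_nn_integral:
  assumes ind: "indep_var S X T Y" and h [measurable]: "h \<in> borel_measurable (S \<Otimes>\<^sub>M T)"
  shows "(\<integral>\<^sup>+\<omega>. h (X \<omega>, Y \<omega>) \<partial>M) = (\<integral>\<^sup>+u. (\<integral>\<^sup>+\<omega>. h (u, Y \<omega>) \<partial>M) \<partial>distr M S X)"
proof -
  have X [measurable]: "X \<in> measurable M S" and Y [measurable]: "Y \<in> measurable M T"
    using ind by (auto dest: indep_var_rv1 indep_var_rv2)
  interpret Y: prob_space "distr M T Y" by (rule prob_space_distr) fact
  have "(\<integral>\<^sup>+\<omega>. h (X \<omega>, Y \<omega>) \<partial>M) = (\<integral>\<^sup>+z. h z \<partial>distr M (S \<Otimes>\<^sub>M T) (\<lambda>\<omega>. (X \<omega>, Y \<omega>)))"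
    by (subst nn_integral_distr) auto
  also have "distr M (S \<Otimes>\<^sub>M T) (\<lambda>\<omega>. (X \<omega>, Y \<omega>)) = distr M S X \<Otimes>\<^sub>M distr M T Y"
    using ind by (simp add: indep_var_distribution_eq)
  also have "(\<integral>\<^sup>+z. h z \<partial>(distr M S X \<Otimes>\<^sub>M distr M T Y)) = (\<integral>\<^sup>+u. (\<integral>\<^sup>+y. h (u, y) \<partial>distr M T Y) \<partial>distr M S X)"
    by (rule Y.nn_integral_fst[symmetric]) simp
  also have "\<dots> = (\<integral>\<^sup>+u. (\<integral>\<^sup>+\<omega>. h (u, Y \<omega>) \<partial>M) \<partial>distr M S X)"
    by (intro nn_integral_cong nn_integral_distr) auto
  finally show ?thesis .
qed

text \<open>Children carry the labels \<open>1, 2, \<dots>\<close>; shifting them to start at 0 makes all index sets equal to the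
  type of natural numbers, and the zero padding of the node vector makes the missing children
  contribute 0. Negative weights occur only on a null set, so they are cut off.\<close>

definition child_weight :: "nat \<Rightarrow> real \<times> enat \<times> (nat \<Rightarrow> real) \<Rightarrow> real" where
  "child_weight j u = max 0 (snd (snd u) (Suc j))"

lemma child_weight_nonneg [simp]: "0 \<le> child_weight j u"
  unfolding child_weight_def by simp

lemma child_weight_measurable [measurable]: "child_weight j \<in> borel_measurable node_vector_algebra"
  unfolding child_weight_def by measurable

text \<open>The sum over the \<open>n\<close>-th generation below \<open>v\<close>, with \<open>Q\<^sup>+\<close> in place of \<open>Q\<close>, as a function of the family
  of all node vectors. The recursion splits off the first step from \<open>v\<close>, whereas generations and
  path weights are built by appending a last step: only the first step exhibits a sum over
  independent copies.\<close>

primrec subtree_sum :: "nat \<Rightarrow> nat list \<Rightarrow> (nat list \<Rightarrow> real \<times> enat \<times> (nat \<Rightarrow> real)) \<Rightarrow> ennreal" where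
  "subtree_sum 0 v f = ennreal (fst (f v))"
| "subtree_sum (Suc n) v f = (\<Sum>j. ennreal (child_weight j (f v)) * subtree_sum n (v @ [Suc j]) f)"

definition subtree :: "nat list \<Rightarrow> nat list set" where
  "subtree v = {v @ w | w. w \<in> nodes}"

lemma subtree_self: "v \<in> subtree v" unfolding subtree_def nodes_def by force

lemma subtree_child: "subtree (v @ [Suc j]) \<subseteq> subtree v - {v}"
  unfolding subtree_def nodes_def by force

lemma subtree_children_disjoint: "disjoint_family (\<lambda>j. subtree (v @ [Suc j]))"
  unfolding subtree_def disjoint_family_on_def by auto

lemma subtree_nodes: "v \<in> nodes \<Longrightarrow> subtree v \<subseteq> nodes"
  unfolding subtree_def nodes_def by auto

lemma subtree_sum_restrict:
  "subtree v \<subseteq> I \<Longrightarrow> subtree_sum n v (restrict f I) = subtree_sum n v f"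
proof (induction n arbitrary: v)
  case 0
  then show ?case using subtree_self[of v] by auto
next
  case (Suc n)
  have "subtree (v @ [Suc j]) \<subseteq> I" for j using Suc.prems subtree_child[of v j] by auto
  then show ?case using Suc subtree_self[of v] by auto
qed

lemma subtree_sum_measurable:
  "subtree v \<subseteq> I \<Longrightarrow> subtree_sum n v \<in> borel_measurable (\<Pi>\<^sub>M i\<in>I. node_vector_algebra)"
proof (induction n arbitrary: v)
  case 0
  then have v: "v \<in> I" using subtree_self[of v] by auto
  have [measurable]: "(\<lambda>f. f v) \<in> (\<Pi>\<^sub>M i\<in>I. node_vector_algebra) \<rightarrow>\<^sub>M node_vector_algebra"
    by (rule measurable_component_singleton[OF v])
  have "(\<lambda>f. ennreal (fst (f v))) \<in> borel_measurable (\<Pi>\<^sub>M i\<in>I. node_vector_algebra)" by measurable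
  then show ?case by (simp add: fun_eq_iff[symmetric] cong: measurable_cong)
next
  case (Suc n)
  then have v: "v \<in> I" using subtree_self[of v] by auto
  have [measurable]: "(\<lambda>f. f v) \<in> (\<Pi>\<^sub>M i\<in>I. node_vector_algebra) \<rightarrow>\<^sub>M node_vector_algebra"
    by (rule measurable_component_singleton[OF v])
  have [measurable]: "subtree_sum n (v @ [Suc j]) \<in> borel_measurable (\<Pi>\<^sub>M i\<in>I. node_vector_algebra)" for j
    using Suc.prems subtree_child[of v j] by (intro Suc.IH) auto
  have "(\<lambda>f. \<Sum>j. ennreal (child_weight j (f v)) * subtree_sum n (v @ [Suc j]) f)
    \<in> borel_measurable (\<Pi>\<^sub>M i\<in>I. node_vector_algebra)" by measurable
  then show ?case by (simp cong: measurable_cong)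
qed

context weighted_branching_tree
begin

abbreviation X :: "nat list \<Rightarrow> 'a \<Rightarrow> real \<times> enat \<times> (nat \<Rightarrow> real)" where
  "X \<equiv> node_vector Q N C"

abbreviation root_law :: "(real \<times> enat \<times> (nat \<Rightarrow> real)) measure" where
  "root_law \<equiv> distr M node_vector_algebra (X [])"

lemma X_measurable [measurable]: "v \<in> nodes \<Longrightarrow> X v \<in> M \<rightarrow>\<^sub>M node_vector_algebra"
  using independent unfolding indep_vars_def by auto

definition branch_sum :: "nat \<Rightarrow> nat list \<Rightarrow> 'a \<Rightarrow> ennreal" where
  "branch_sum n v \<omega> = subtree_sum n v (\<lambda>w. X w \<omega>)"

lemma branch_sum_0: "branch_sum 0 v \<omega> = ennreal (fst (X v \<omega>))"
  by (simp add: branch_sum_def)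

lemma branch_sum_Suc:
  "branch_sum (Suc n) v \<omega> = (\<Sum>j. ennreal (child_weight j (X v \<omega>)) * branch_sum n (v @ [Suc j]) \<omega>)"
  by (simp add: branch_sum_def)

lemma child_node: "v \<in> nodes \<Longrightarrow> v @ [Suc j] \<in> nodes"
  unfolding nodes_def by auto

lemma branch_sum_eq: "branch_sum n v \<omega> = subtree_sum n v (restrict (\<lambda>w. X w \<omega>) (subtree v))"
  by (simp add: branch_sum_def subtree_sum_restrict)

lemma indep_branches:
  assumes "v \<in> nodes"
  shows "indep_vars (\<lambda>_. borel) (\<lambda>j. branch_sum n (v @ [Suc j])) UNIV"
proof -
  have "indep_vars (\<lambda>j. \<Pi>\<^sub>M i\<in>subtree (v @ [Suc j]). node_vector_algebra)
      (\<lambda>j \<omega>. restrict (\<lambda>w. X w \<omega>) (subtree (v @ [Suc j]))) UNIV"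
    using subtree_nodes[OF child_node[OF assms]] subtree_children_disjoint
    by (intro indep_vars_restrict[OF independent]) auto
  then have "indep_vars (\<lambda>_. borel)
      (\<lambda>j \<omega>. subtree_sum n (v @ [Suc j]) (restrict (\<lambda>w. X w \<omega>) (subtree (v @ [Suc j])))) UNIV"
    by (rule indep_vars_compose2) (rule subtree_sum_measurable, simp)
  then show ?thesis by (simp add: branch_sum_eq[symmetric])
qed

lemma branch_sum_measurable [measurable]: "v \<in> nodes \<Longrightarrow> branch_sum n v \<in> borel_measurable M"
proof -
  assume v: "v \<in> nodes"
  have "(\<lambda>\<omega>. restrict (\<lambda>w. X w \<omega>) (subtree v)) \<in> M \<rightarrow>\<^sub>M (\<Pi>\<^sub>M i\<in>subtree v. node_vector_algebra)"
    using subtree_nodes[OF v] by (intro measurable_restrict X_measurable) auto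
  then have "(\<lambda>\<omega>. subtree_sum n v (restrict (\<lambda>w. X w \<omega>) (subtree v))) \<in> borel_measurable M"
    by (rule measurable_compose[OF _ subtree_sum_measurable]) simp
  then show ?thesis by (simp add: branch_sum_eq[symmetric])
qed

text \<open>The vector at \<open>v\<close> is independent of the subtrees below the children of \<open>v\<close>, and its law is that of
  the root.\<close>

lemma condition_on_vector:
  assumes v: "v \<in> nodes" and h: "h \<in> borel_measurable borel"
  shows "(\<integral>\<^sup>+\<omega>. h (branch_sum (Suc n) v \<omega>) \<partial>M)
    = (\<integral>\<^sup>+u. (\<integral>\<^sup>+\<omega>. h (\<Sum>j. ennreal (child_weight j u) * branch_sum n (v @ [Suc j]) \<omega>) \<partial>M) \<partial>root_law)"
proof -
  let ?B = "\<Union>j. subtree (v @ [Suc j])"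
  let ?P = "\<lambda>I. \<Pi>\<^sub>M i\<in>I. node_vector_algebra"
  have sub: "subtree (v @ [Suc j]) \<subseteq> ?B" for j by auto
  have ind: "indep_var (?P {v}) (\<lambda>\<omega>. restrict (\<lambda>i. X i \<omega>) {v}) (?P ?B) (\<lambda>\<omega>. restrict (\<lambda>i. X i \<omega>) ?B)"
  proof (rule indep_var_restrict[OF independent])
    show "{v} \<inter> ?B = {}" using subtree_child[of v] by auto
    show "{v} \<subseteq> nodes" using v by simp
    show "?B \<subseteq> nodes" using subtree_nodes[OF child_node[OF v]] by auto
  qed
  have rv: "(\<lambda>\<omega>. restrict (\<lambda>i. X i \<omega>) {v}) \<in> M \<rightarrow>\<^sub>M ?P {v}" using ind by (rule indep_var_rv1)
  define H where "H z = h (\<Sum>j. ennreal (child_weight j (fst z v)) * subtree_sum n (v @ [Suc j]) (snd z))"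
    for z :: "(nat list \<Rightarrow> real \<times> enat \<times> (nat \<Rightarrow> real)) \<times> (nat list \<Rightarrow> real \<times> enat \<times> (nat \<Rightarrow> real))"
  have cv [measurable]: "(\<lambda>f. f v) \<in> ?P {v} \<rightarrow>\<^sub>M node_vector_algebra"
    by (rule measurable_component_singleton) simp
  have [measurable]: "subtree_sum n (v @ [Suc j]) \<in> borel_measurable (?P ?B)" for j
    by (rule subtree_sum_measurable[OF sub])
  have "(\<lambda>z. \<Sum>j. ennreal (child_weight j (fst z v)) * subtree_sum n (v @ [Suc j]) (snd z)) \<in> borel_measurable (?P {v} \<Otimes>\<^sub>M ?P ?B)"
    by measurable
  then have Hm [measurable]: "H \<in> borel_measurable (?P {v} \<Otimes>\<^sub>M ?P ?B)"
    unfolding H_def by (rule measurable_compose[OF _ h])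
  define k where "k u = (\<integral>\<^sup>+\<omega>. h (\<Sum>j. ennreal (child_weight j u) * branch_sum n (v @ [Suc j]) \<omega>) \<partial>M)" for u
  have [measurable]: "branch_sum n (v @ [Suc j]) \<in> borel_measurable M" for j
    using v by (intro branch_sum_measurable child_node)
  have "(\<lambda>z. \<Sum>j. ennreal (child_weight j (fst z)) * branch_sum n (v @ [Suc j]) (snd z)) \<in> borel_measurable (node_vector_algebra \<Otimes>\<^sub>M M)"
    by measurable
  then have "(\<lambda>z. h (\<Sum>j. ennreal (child_weight j (fst z)) * branch_sum n (v @ [Suc j]) (snd z))) \<in> borel_measurable (node_vector_algebra \<Otimes>\<^sub>M M)"
    by (rule measurable_compose[OF _ h])
  then have km: "k \<in> borel_measurable node_vector_algebra"
    unfolding k_def by (intro borel_measurable_nn_integral) (simp add: case_prod_beta')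
  have "(\<integral>\<^sup>+\<omega>. h (branch_sum (Suc n) v \<omega>) \<partial>M)
    = (\<integral>\<^sup>+\<omega>. H (restrict (\<lambda>i. X i \<omega>) {v}, restrict (\<lambda>i. X i \<omega>) ?B) \<partial>M)"
    unfolding H_def by (simp add: branch_sum_Suc subtree_sum_restrict[OF sub] branch_sum_def)
  also have "\<dots> = (\<integral>\<^sup>+f. (\<integral>\<^sup>+\<omega>. H (f, restrict (\<lambda>i. X i \<omega>) ?B) \<partial>M) \<partial>distr M (?P {v}) (\<lambda>\<omega>. restrict (\<lambda>i. X i \<omega>) {v}))"
    by (rule indep_var_nn_integral[OF ind Hm])
  also have "\<dots> = (\<integral>\<^sup>+f. k (f v) \<partial>distr M (?P {v}) (\<lambda>\<omega>. restrict (\<lambda>i. X i \<omega>) {v}))"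
    unfolding H_def k_def by (simp add: subtree_sum_restrict[OF sub] branch_sum_def)
  also have "\<dots> = (\<integral>\<^sup>+\<omega>. k (X v \<omega>) \<partial>M)"
    using rv measurable_compose[OF cv km] by (subst nn_integral_distr) auto
  also have "\<dots> = (\<integral>\<^sup>+u. k u \<partial>distr M node_vector_algebra (X v))"
    using X_measurable[OF v] km by (intro nn_integral_distr[symmetric]) auto
  finally show ?thesis unfolding k_def identically_distributed[OF v] .
qed

lemma tail_condition_on_vector:
  assumes v: "v \<in> nodes"
  shows "emeasure M {\<omega> \<in> space M. branch_sum (Suc n) v \<omega> > t}
    = (\<integral>\<^sup>+u. emeasure M {\<omega> \<in> space M. (\<Sum>j. ennreal (child_weight j u) * branch_sum n (v @ [Suc j]) \<omega>) > t} \<partial>root_law)"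
proof -
  have [measurable]: "branch_sum n (v @ [Suc j]) \<in> borel_measurable M" for j
    using v by (intro branch_sum_measurable child_node)
  have [measurable]: "branch_sum (Suc n) v \<in> borel_measurable M"
    using v by (intro branch_sum_measurable)
  have *: "(\<integral>\<^sup>+\<omega>. indicator {t<..} (f \<omega>) \<partial>M) = emeasure M {\<omega> \<in> space M. f \<omega> > t}"
    if [measurable]: "f \<in> borel_measurable M" for f :: "'a \<Rightarrow> ennreal"
  proof -
    have "(\<integral>\<^sup>+\<omega>. indicator {t<..} (f \<omega>) \<partial>M) = (\<integral>\<^sup>+\<omega>. indicator {\<omega> \<in> space M. f \<omega> > t} \<omega> \<partial>M)"
      by (intro nn_integral_cong) (auto simp: indicator_def)
    then show ?thesis by simp
  qed
  have "indicator {t<..} \<in> borel_measurable (borel :: ennreal measure)" by measurable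
  from condition_on_vector[OF v this, of n] show ?thesis by (simp add: *)
qed

section \<open>Induction over the generations\<close>

lemma root_law_transfer:
  assumes "v \<in> nodes" "h \<in> borel_measurable node_vector_algebra"
  shows "(\<integral>\<^sup>+\<omega>. h (X v \<omega>) \<partial>M) = (\<integral>\<^sup>+u. h u \<partial>root_law)"
proof -
  have "(\<integral>\<^sup>+\<omega>. h (X v \<omega>) \<partial>M) = (\<integral>\<^sup>+u. h u \<partial>distr M node_vector_algebra (X v))"
    using assms X_measurable by (intro nn_integral_distr[symmetric]) auto
  then show ?thesis unfolding identically_distributed[OF assms(1)] .
qed

lemma Nil_node: "[] \<in> nodes" unfolding nodes_def by simp

text \<open>Since \<open>\<rho> \<le> \<eta>\<close>, every generation multiplies the mean by at most \<open>\<eta>\<close>.\<close>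

lemma branch_sum_mean:
  assumes mean: "(\<integral>\<^sup>+\<omega>. ennreal (Q [] \<omega>) \<partial>M) \<le> ennreal m"
    and \<rho>: "(\<integral>\<^sup>+u. (\<Sum>j. ennreal (child_weight j u)) \<partial>root_law) \<le> ennreal \<eta>" and m: "0 \<le> m" "0 \<le> \<eta>"
  shows "v \<in> nodes \<Longrightarrow> (\<integral>\<^sup>+\<omega>. branch_sum n v \<omega> \<partial>M) \<le> ennreal (m * \<eta> ^ n)"
proof (induction n arbitrary: v)
  case 0
  have "(\<integral>\<^sup>+\<omega>. ennreal (fst (X v \<omega>)) \<partial>M) = (\<integral>\<^sup>+\<omega>. ennreal (fst (X [] \<omega>)) \<partial>M)"
    using root_law_transfer[OF 0, of "\<lambda>u. ennreal (fst u)"] root_law_transfer[OF Nil_node, of "\<lambda>u. ennreal (fst u)"] by simp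
  then show ?case using mean by (simp add: branch_sum_0 node_vector_def)
next
  case (Suc n)
  have bm: "branch_sum n (v @ [Suc j]) \<in> borel_measurable M" for j
    using Suc.prems by (intro branch_sum_measurable child_node)
  have "(\<integral>\<^sup>+\<omega>. branch_sum (Suc n) v \<omega> \<partial>M)
    = (\<integral>\<^sup>+u. (\<integral>\<^sup>+\<omega>. (\<Sum>j. ennreal (child_weight j u) * branch_sum n (v @ [Suc j]) \<omega>) \<partial>M) \<partial>root_law)"
    by (rule condition_on_vector[OF Suc.prems]) simp
  also have "\<dots> \<le> (\<integral>\<^sup>+u. ennreal (m * \<eta> ^ n) * (\<Sum>j. ennreal (child_weight j u)) \<partial>root_law)"
    by (intro nn_integral_mono weighted_sum_mean bm Suc.IH child_node Suc.prems)
  also have "\<dots> = ennreal (m * \<eta> ^ n) * (\<integral>\<^sup>+u. (\<Sum>j. ennreal (child_weight j u)) \<partial>root_law)"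
    by (rule nn_integral_cmult) measurable
  also have "\<dots> \<le> ennreal (m * \<eta> ^ n) * ennreal \<eta>" by (intro mult_left_mono \<rho>) simp
  also have "\<dots> = ennreal (m * \<eta> ^ Suc n)" using m by (simp add: ennreal_mult[symmetric] mult_ac)
  finally show ?case .
qed

end

lemma (in weight_law) scaled_tail_bound:
  fixes Y :: "'c \<Rightarrow> ennreal"
  assumes [measurable]: "Y \<in> borel_measurable M"
    and mean: "(\<integral>\<^sup>+\<omega>. Y \<omega> \<partial>M) \<le> ennreal (m * r)"
    and tail: "\<And>y. 1 \<le> y \<Longrightarrow> emeasure M {\<omega> \<in> space M. Y \<omega> > ennreal y} \<le> ennreal (K * r * G y)"
    and u: "0 \<le> u" and y: "1 \<le> y" and nonneg: "0 \<le> K" "0 \<le> r" "0 \<le> m"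
  shows "emeasure M {\<omega> \<in> space M. ennreal u * Y \<omega> > ennreal y} \<le> ennreal (tail_bound K m r y u)"
proof (cases "u = 0")
  case False
  with u have u0: "0 < u" by simp
  have "ennreal u * t > ennreal y \<longleftrightarrow> t > ennreal (y / u)" for t
  proof (cases t)
    case (real s)
    have "y < u * s \<longleftrightarrow> y / u < s" using u0 by (simp add: field_simps)
    then show ?thesis using real u0 y by (simp add: ennreal_mult[symmetric] ennreal_less_iff)
  qed (use u0 in \<open>auto simp: ennreal_mult_top\<close>)
  then have eq: "{\<omega> \<in> space M. ennreal u * Y \<omega> > ennreal y} = {\<omega> \<in> space M. Y \<omega> > ennreal (y / u)}" by simp
  show ?thesis
  proof (cases "u \<le> y")
    case True
    have "emeasure M {\<omega> \<in> space M. Y \<omega> > ennreal (y / u)} \<le> ennreal (K * r * G (y / u))"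
      using True u0 by (intro tail) simp
    also have "\<dots> \<le> ennreal (tail_bound K m r y u)"
      using u0 nonneg by (intro ennreal_leI) (simp add: tail_bound_def algebra_simps)
    finally show ?thesis unfolding eq .
  next
    case nle: False
    have "emeasure M {\<omega> \<in> space M. Y \<omega> > ennreal (y / u)} \<le> ennreal (1 / (y / u)) * (\<integral>\<^sup>+\<omega>. Y \<omega> \<partial>M)"
      using u0 y by (intro markov_bound) auto
    also have "\<dots> \<le> ennreal (1 / (y / u)) * ennreal (m * r)" by (intro mult_left_mono mean) simp
    also have "\<dots> = ennreal (r * m * (u / y))" using u0 y nonneg by (simp add: ennreal_mult[symmetric] mult_ac)
    also have "\<dots> \<le> ennreal (tail_bound K m r y u)"
    proof (rule ennreal_leI)
      have "(u / y) powr 1 \<le> (u / y) powr b" using nle y b_gt \<alpha>_gt1 by (intro powr_mono) auto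
      then have "u / y \<le> (u / y) powr b" using u0 y by simp
      then have "r * m * (u / y) \<le> r * m * (u / y) powr b" using nonneg by (intro mult_left_mono) auto
      moreover have "0 \<le> r * K * G (y / u)" using nonneg less_imp_le[OF G_pos] by simp
      ultimately show "r * m * (u / y) \<le> tail_bound K m r y u"
        using u0 by (simp add: tail_bound_def distrib_left mult.assoc)
    qed
    finally show ?thesis unfolding eq .
  qed
qed (use y in simp)

context weighted_branching_tree
begin

text \<open>Conditionally on the vector at \<open>v\<close>, the branch sum is a weighted sum of independent variables to
  which the single-jump bound applies; the tails of its terms are bounded by the induction
  hypothesis.\<close>

lemma branch_sum_tail_step:
  assumes law: "weight_law root_law child_weight G \<alpha> b" and v: "v \<in> nodes"
    and mean: "\<And>w. w \<in> nodes \<Longrightarrow> (\<integral>\<^sup>+\<omega>. branch_sum n w \<omega> \<partial>M) \<le> ennreal (m * r)"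
    and tail: "\<And>w y. w \<in> nodes \<Longrightarrow> 1 \<le> y \<Longrightarrow>
      emeasure M {\<omega> \<in> space M. branch_sum n w \<omega> > ennreal y} \<le> ennreal (K * r * G y)"
    and nonneg: "0 \<le> K" "0 \<le> r" "0 \<le> m" and p: "0 < p" and \<delta>: "0 < \<delta>" "\<delta> < 1"
    and x: "1 \<le> x / real p" "1 \<le> (1 - \<delta>) * x"
  shows "emeasure M {\<omega> \<in> space M. branch_sum (Suc n) v \<omega> > ennreal x}
    \<le> (\<integral>\<^sup>+u. ennreal (exp 1) * min 1 (ennreal (m * r * real p / x) * (\<Sum>j. ennreal (child_weight j u))) ^ p
        + (\<Sum>j. ennreal (weight_law.tail_bound G b K m r ((1 - \<delta>) * x) (child_weight j u)))
        + (\<Sum>j. ennreal (weight_law.tail_bound G b K m r (x / real p) (child_weight j u)))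
          * min 1 (ennreal (m * r / (\<delta> * x)) * (\<Sum>j. ennreal (child_weight j u))) \<partial>root_law)"
proof -
  interpret W: weight_law root_law child_weight G \<alpha> b by (rule law)
  have bm [measurable]: "branch_sum n (v @ [Suc j]) \<in> borel_measurable M" for j
    using v by (intro branch_sum_measurable child_node)
  have x0: "0 < x" using x p by (smt (verit) divide_nonpos_nonneg of_nat_0_le_iff)
  have tb: "emeasure M {\<omega> \<in> space M. ennreal (child_weight j u) * branch_sum n (v @ [Suc j]) \<omega> > ennreal y}
     \<le> ennreal (W.tail_bound K m r y (child_weight j u))" if "1 \<le> y" for j u y
    using that nonneg child_node[OF v]
    by (intro W.scaled_tail_bound bm mean tail) auto
  show ?thesis
    unfolding tail_condition_on_vector[OF v]
  proof (rule nn_integral_mono)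
    fix u
    have "emeasure M {\<omega> \<in> space M. (\<Sum>j. ennreal (child_weight j u) * branch_sum n (v @ [Suc j]) \<omega>) > ennreal x}
    \<le> ennreal (exp 1) * min 1 (ennreal (m * r * real p / x) * (\<Sum>j. ennreal (child_weight j u))) ^ p
      + (\<Sum>j. emeasure M {\<omega> \<in> space M. ennreal (child_weight j u) * branch_sum n (v @ [Suc j]) \<omega> > ennreal ((1 - \<delta>) * x)})
      + (\<Sum>j. emeasure M {\<omega> \<in> space M. ennreal (child_weight j u) * branch_sum n (v @ [Suc j]) \<omega> > ennreal (x / real p)})
        * min 1 (ennreal (m * r / (\<delta> * x)) * (\<Sum>j. ennreal (child_weight j u)))"
      using nonneg by (intro weighted_sum_tail indep_branches v mean child_node x0 p \<delta>) auto
    also have "\<dots> \<le> ennreal (exp 1) * min 1 (ennreal (m * r * real p / x) * (\<Sum>j. ennreal (child_weight j u))) ^ p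
      + (\<Sum>j. ennreal (W.tail_bound K m r ((1 - \<delta>) * x) (child_weight j u)))
      + (\<Sum>j. ennreal (W.tail_bound K m r (x / real p) (child_weight j u)))
        * min 1 (ennreal (m * r / (\<delta> * x)) * (\<Sum>j. ennreal (child_weight j u)))"
      by (intro add_mono mult_right_mono suminf_le tb x order_refl) auto
    finally show "emeasure M {\<omega> \<in> space M. (\<Sum>j. ennreal (child_weight j u) * branch_sum n (v @ [Suc j]) \<omega>) > ennreal x}
      \<le> ennreal (exp 1) * min 1 (ennreal (m * r * real p / x) * (\<Sum>j. ennreal (child_weight j u))) ^ p
      + (\<Sum>j. ennreal (W.tail_bound K m r ((1 - \<delta>) * x) (child_weight j u)))
      + (\<Sum>j. ennreal (W.tail_bound K m r (x / real p) (child_weight j u)))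
        * min 1 (ennreal (m * r / (\<delta> * x)) * (\<Sum>j. ennreal (child_weight j u)))" .
  qed
qed

lemma root_mean_finite:
  assumes "(\<integral>\<^sup>+\<omega>. ennreal (max (Q [] \<omega>) 0 powr b) \<partial>M) < \<infinity>" "1 \<le> b"
  obtains m where "0 < m" "(\<integral>\<^sup>+\<omega>. ennreal (Q [] \<omega>) \<partial>M) \<le> ennreal m"
proof -
  have "X [] \<in> M \<rightarrow>\<^sub>M node_vector_algebra" by (rule X_measurable[OF Nil_node])
  then have "(\<lambda>\<omega>. fst (X [] \<omega>)) \<in> borel_measurable M" by measurable
  then have [measurable]: "Q [] \<in> borel_measurable M" by (simp add: node_vector_def)
  obtain r where r: "(\<integral>\<^sup>+\<omega>. ennreal (max (Q [] \<omega>) 0 powr b) \<partial>M) = ennreal r" "0 \<le> r"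
    using assms(1) by (rule finite_ennrealE)
  have le: "ennreal q \<le> 1 + ennreal (max q 0 powr b)" for q
  proof (cases "1 \<le> q")
    case True
    then have "q powr 1 \<le> q powr b" using assms by (intro powr_mono) auto
    then have "ennreal q \<le> ennreal (q powr b)" using True by (intro ennreal_leI) auto
    then show ?thesis using True by (auto intro: add_increasing)
  next
    case False
    then have "ennreal q \<le> ennreal 1" by (intro ennreal_leI) auto
    then show ?thesis by (auto intro: add_increasing2)
  qed
  show thesis
  proof (rule that[of "1 + r"])
    have "(\<integral>\<^sup>+\<omega>. ennreal (Q [] \<omega>) \<partial>M) \<le> (\<integral>\<^sup>+\<omega>. 1 + ennreal (max (Q [] \<omega>) 0 powr b) \<partial>M)"
      by (intro nn_integral_mono le)
    also have "\<dots> = 1 + ennreal r" by (subst nn_integral_add) (auto simp: r emeasure_space_1)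
    finally show "(\<integral>\<^sup>+\<omega>. ennreal (Q [] \<omega>) \<partial>M) \<le> ennreal (1 + r)" using r by simp
  qed (use r in simp)
qed

text \<open>In generation 0 Markov's inequality gives the order \<open>x\<^sup>-\<^sup>b\<close>, which is smaller than that of \<open>G x\<close>.\<close>

lemma branch_sum_tail_0:
  assumes law: "weight_law root_law child_weight G \<alpha> b"
    and q: "(\<integral>\<^sup>+\<omega>. ennreal (max (Q [] \<omega>) 0 powr b) \<partial>M) < \<infinity>"
  obtains K where "0 \<le> K" "\<And>v x. v \<in> nodes \<Longrightarrow> 1 \<le> x \<Longrightarrow>
    emeasure M {\<omega> \<in> space M. branch_sum 0 v \<omega> > ennreal x} \<le> ennreal (K * G x)"
proof -
  interpret W: weight_law root_law child_weight G \<alpha> b by (rule law)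
  obtain B where B: "B > 0" "\<And>x. 1 \<le> x \<Longrightarrow> x powr (- b) \<le> B * G x"
    using W.power_lower_bound by blast
  obtain q0 where q0: "(\<integral>\<^sup>+\<omega>. ennreal (max (Q [] \<omega>) 0 powr b) \<partial>M) = ennreal q0" "0 \<le> q0"
    using q by (rule finite_ennrealE)
  have b0: "0 < b" using W.b_gt W.\<alpha>_gt1 by simp
  show thesis
  proof (rule that[of "B * q0"])
    show "0 \<le> B * q0" using B q0 by simp
    fix v :: "nat list" and x :: real assume v: "v \<in> nodes" and x: "1 \<le> x"
    have Xm [measurable]: "X v \<in> M \<rightarrow>\<^sub>M node_vector_algebra" by (rule X_measurable[OF v])
    have hm: "(\<lambda>u. ennreal (max (fst u) 0 powr b)) \<in> borel_measurable node_vector_algebra" by measurable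
    have "(\<integral>\<^sup>+\<omega>. ennreal (max (fst (X v \<omega>)) 0 powr b) \<partial>M) = (\<integral>\<^sup>+\<omega>. ennreal (max (fst (X [] \<omega>)) 0 powr b) \<partial>M)"
      using root_law_transfer[OF v hm] root_law_transfer[OF Nil_node hm] by simp
    then have qv: "(\<integral>\<^sup>+\<omega>. ennreal (max (fst (X v \<omega>)) 0 powr b) \<partial>M) = ennreal q0"
      by (simp add: node_vector_def q0(1))
    have "emeasure M {\<omega> \<in> space M. branch_sum 0 v \<omega> > ennreal x}
      \<le> emeasure M {\<omega> \<in> space M. ennreal (max (fst (X v \<omega>)) 0 powr b) > ennreal (x powr b)}"
    proof (intro emeasure_mono subsetI)
      fix \<omega> assume "\<omega> \<in> {\<omega> \<in> space M. branch_sum 0 v \<omega> > ennreal x}"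
      then have "\<omega> \<in> space M" "x < fst (X v \<omega>)" using x by (auto simp: branch_sum_0 ennreal_less_iff)
      then show "\<omega> \<in> {\<omega> \<in> space M. ennreal (max (fst (X v \<omega>)) 0 powr b) > ennreal (x powr b)}"
        using x b0 by (auto simp: ennreal_less_iff intro!: powr_less_mono2)
    qed measurable
    also have "\<dots> \<le> ennreal (1 / (x powr b)) * ennreal q0"
      unfolding qv[symmetric] using x by (intro markov_bound) auto
    also have "\<dots> = ennreal (x powr (- b) * q0)"
      using q0 by (simp add: ennreal_mult[symmetric] powr_minus divide_inverse)
    also have "\<dots> \<le> ennreal (B * q0 * G x)"
    proof (rule ennreal_leI)
      have "x powr (- b) * q0 \<le> (B * G x) * q0" by (intro mult_right_mono B x q0)
      then show "x powr (- b) * q0 \<le> B * q0 * G x" by (simp add: mult_ac)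
    qed
    finally show "emeasure M {\<omega> \<in> space M. branch_sum 0 v \<omega> > ennreal x} \<le> ennreal (B * q0 * G x)" .
  qed
qed

text \<open>Induction on \<open>n\<close> with a fixed constant \<open>K\<close>, simultaneously for all roots \<open>v\<close>; in this way the
  branches at different nodes need not be shown to have equal laws.\<close>

lemma branch_sum_tail:
  assumes law: "weight_law root_law child_weight G \<alpha> b"
    and q: "(\<integral>\<^sup>+\<omega>. ennreal (max (Q [] \<omega>) 0 powr b) \<partial>M) < \<infinity>"
    and \<rho>1: "(\<integral>\<^sup>+u. (\<Sum>j. ennreal (child_weight j u)) \<partial>root_law) \<le> ennreal \<eta>"
    and \<rho>\<alpha>: "(\<integral>\<^sup>+u. (\<Sum>j. ennreal (child_weight j u powr \<alpha>)) \<partial>root_law) < ennreal \<eta>"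
    and \<eta>: "0 < \<eta>" "\<eta> \<le> 1"
  obtains K where "0 < K" "\<And>n v x. v \<in> nodes \<Longrightarrow> 1 \<le> x \<Longrightarrow>
    emeasure M {\<omega> \<in> space M. branch_sum n v \<omega> > ennreal x} \<le> ennreal (K * \<eta> ^ n * G x)"
proof -
  interpret W: weight_law root_law child_weight G \<alpha> b by (rule law)
  have "1 \<le> b" using W.b_gt W.\<alpha>_gt1 by simp
  with q obtain m where m: "0 < m" "(\<integral>\<^sup>+\<omega>. ennreal (Q [] \<omega>) \<partial>M) \<le> ennreal m"
    by (rule root_mean_finite)
  have mean: "(\<integral>\<^sup>+\<omega>. branch_sum n v \<omega> \<partial>M) \<le> ennreal (m * \<eta> ^ n)" if "v \<in> nodes" for n v
    using m \<eta> that by (intro branch_sum_mean[OF m(2) \<rho>1]) auto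
  obtain K0 where K0: "0 \<le> K0" "\<And>v x. v \<in> nodes \<Longrightarrow> 1 \<le> x \<Longrightarrow>
    emeasure M {\<omega> \<in> space M. branch_sum 0 v \<omega> > ennreal x} \<le> ennreal (K0 * G x)"
    using branch_sum_tail_0[OF law q] by blast
  obtain \<theta> B x0 \<delta> and p :: nat where
    par: "0 \<le> \<theta>" "\<theta> < \<eta>" "0 \<le> B" "1 \<le> x0" "0 < p" "0 < \<delta>" "\<delta> < 1"
    "\<And>x. x0 \<le> x \<Longrightarrow> 1 \<le> x / real p \<and> 1 \<le> (1 - \<delta>) * x"
    and step: "\<And>K r x. 0 \<le> K \<Longrightarrow> 0 < r \<Longrightarrow> r \<le> 1 \<Longrightarrow> x0 \<le> x \<Longrightarrow>
      (\<integral>\<^sup>+u. ennreal (exp 1) * min 1 (ennreal (m * r * real p / x) * W.Z u) ^ p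
        + (\<Sum>j. ennreal (W.tail_bound K m r ((1 - \<delta>) * x) (child_weight j u)))
        + (\<Sum>j. ennreal (W.tail_bound K m r (x / real p) (child_weight j u))) * min 1 (ennreal (m * r / (\<delta> * x)) * W.Z u) \<partial>root_law)
      \<le> ennreal ((\<theta> * K + B) * r * G x)"
    by (rule W.generation_step_integral[OF \<rho>\<alpha> m(1)]) blast
  \<comment> \<open>\<open>K0\<close> starts the induction, \<open>B / (\<eta> - \<theta>)\<close> gives \<open>\<theta> K + B \<le> \<eta> K\<close>, and \<open>m / G x0\<close> lets the bound by the mean suffice for \<open>x < x0\<close>\<close>
  define K where "K = Max {1, K0, B / (\<eta> - \<theta>), m / G x0}"
  have K: "1 \<le> K" "K0 \<le> K" "B / (\<eta> - \<theta>) \<le> K" "m / G x0 \<le> K" unfolding K_def by auto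
  have G0: "0 < G x" for x by (rule W.G_pos)
  show thesis
  proof (rule that[of K])
    show "0 < K" using K by simp
    fix n v and x :: real
    show "v \<in> nodes \<Longrightarrow> 1 \<le> x \<Longrightarrow>
      emeasure M {\<omega> \<in> space M. branch_sum n v \<omega> > ennreal x} \<le> ennreal (K * \<eta> ^ n * G x)"
    proof (induction n arbitrary: v x)
      case 0
      have "emeasure M {\<omega> \<in> space M. branch_sum 0 v \<omega> > ennreal x} \<le> ennreal (K0 * G x)"
        by (rule K0(2)[OF 0])
      also have "\<dots> \<le> ennreal (K * \<eta> ^ 0 * G x)"
        using K(2) less_imp_le[OF G0[of x]] by (intro ennreal_leI) (simp add: mult_right_mono)
      finally show ?case .
    next
      case (Suc n)
      have r: "0 < \<eta> ^ n" "\<eta> ^ n \<le> 1" using \<eta> by (auto simp: power_le_one)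
      show ?case
      proof (cases "x0 \<le> x")
        case True
        have "emeasure M {\<omega> \<in> space M. branch_sum (Suc n) v \<omega> > ennreal x}
          \<le> (\<integral>\<^sup>+u. ennreal (exp 1) * min 1 (ennreal (m * \<eta> ^ n * real p / x) * W.Z u) ^ p
        + (\<Sum>j. ennreal (W.tail_bound K m (\<eta> ^ n) ((1 - \<delta>) * x) (child_weight j u)))
        + (\<Sum>j. ennreal (W.tail_bound K m (\<eta> ^ n) (x / real p) (child_weight j u)))
          * min 1 (ennreal (m * \<eta> ^ n / (\<delta> * x)) * W.Z u) \<partial>root_law)"
          unfolding W.Z_def
          by (rule branch_sum_tail_step[OF law Suc.prems(1) mean Suc.IH])
             (use K m r par(5-7) par(8)[OF True] in auto)
        also have "\<dots> \<le> ennreal ((\<theta> * K + B) * \<eta> ^ n * G x)"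
          using K r True by (intro step) auto
        also have "\<dots> \<le> ennreal (K * \<eta> ^ Suc n * G x)"
        proof (rule ennreal_leI)
          have "B \<le> K * (\<eta> - \<theta>)" using K(3) par(2) by (simp add: field_simps)
          then have "\<theta> * K + B \<le> K * \<eta>" by (simp add: algebra_simps)
          then have "(\<theta> * K + B) * (\<eta> ^ n * G x) \<le> (K * \<eta>) * (\<eta> ^ n * G x)"
            using r less_imp_le[OF G0[of x]] by (intro mult_right_mono) auto
          then show "(\<theta> * K + B) * \<eta> ^ n * G x \<le> K * \<eta> ^ Suc n * G x" by (simp add: mult_ac)
        qed
        finally show ?thesis .
      next
        case False
        have "emeasure M {\<omega> \<in> space M. branch_sum (Suc n) v \<omega> > ennreal x} \<le> ennreal (1 / x) * (\<integral>\<^sup>+\<omega>. branch_sum (Suc n) v \<omega> \<partial>M)"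
          using Suc.prems by (intro markov_bound branch_sum_measurable) auto
        also have "\<dots> \<le> ennreal 1 * ennreal (m * \<eta> ^ Suc n)"
          using Suc.prems by (intro mult_mono mean ennreal_leI) auto
        also have "\<dots> \<le> ennreal (K * \<eta> ^ Suc n * G x)"
        proof -
          have "m \<le> K * G x0" using K(4) G0[of x0] by (simp add: field_simps)
          also have "\<dots> \<le> K * G x" using False K by (intro mult_left_mono W.G_mono) auto
          finally have "m * \<eta> ^ Suc n \<le> (K * G x) * \<eta> ^ Suc n" using \<eta> by (intro mult_right_mono) auto
          then show ?thesis by (simp add: mult_ac ennreal_leI)
        qed
        finally show ?thesis .
      qed
    qed
  qed
qed

end

section \<open>From branch sums to generation sums\<close>

lemma infsum_child_indices:
  fixes f :: "nat \<Rightarrow> ennreal"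
  shows "(\<Sum>\<^sub>\<infinity>i\<in>child_indices m. f i) = (\<Sum>j. if Suc j \<in> child_indices m then f (Suc j) else 0)"
proof -
  let ?g = "\<lambda>i. if i \<in> child_indices m then f i else 0"
  have "(\<Sum>\<^sub>\<infinity>i\<in>child_indices m. f i) = (\<Sum>\<^sub>\<infinity>i\<in>range Suc. ?g i)"
  proof (rule infsum_cong_neutral)
    fix i assume "i \<in> child_indices m - range Suc"
    then show "f i = 0" unfolding child_indices_def by (cases i) auto
  qed auto
  also have "\<dots> = (\<Sum>\<^sub>\<infinity>j. ?g (Suc j))" by (subst infsum_reindex) (auto simp: o_def)
  also have "\<dots> = (\<Sum>j. ?g (Suc j))"
    by (intro sums_unique has_sum_imp_sums has_sum_infsum nonneg_summable_on_complete) auto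
  finally show ?thesis .
qed

context weighted_branching_tree
begin

lemma root_sum_eq: "root_sum N C \<omega> = (\<Sum>j. ennreal (child_weight j (X [] \<omega>)))"
  unfolding root_sum_def infsum_child_indices
  by (intro suminf_cong) (auto simp: child_weight_def node_vector_def max_def ennreal_neg)

text \<open>Nonnegativity is a property of the law of the node vector alone, and there are countably many nodes.\<close>

lemma nonneg_weights:
  assumes "AE \<omega> in M. \<forall>i\<in>child_indices (N [] \<omega>). C [i] \<omega> \<ge> 0"
  shows "AE \<omega> in M. \<forall>v\<in>nodes. \<forall>j\<in>child_indices (N v \<omega>). C (v @ [j]) \<omega> \<ge> 0"
proof -
  let ?P = "\<lambda>u :: real \<times> enat \<times> (nat \<Rightarrow> real). \<forall>j. 0 \<le> snd (snd u) j"
  have Pset: "{u \<in> space node_vector_algebra. ?P u} \<in> sets node_vector_algebra" by measurable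
  have iff: "?P (X v \<omega>) \<longleftrightarrow> (\<forall>j\<in>child_indices (N v \<omega>). C (v @ [j]) \<omega> \<ge> 0)" for v \<omega>
    by (auto simp: node_vector_def)
  have "AE \<omega> in M. ?P (X [] \<omega>)" using assms unfolding iff by simp
  then have root: "AE u in root_law. ?P u"
    using X_measurable[OF Nil_node] Pset by (subst AE_distr_iff) auto
  have "AE \<omega> in M. ?P (X v \<omega>)" if v: "v \<in> nodes" for v
  proof -
    have "AE u in distr M node_vector_algebra (X v). ?P u"
      using root unfolding identically_distributed[OF v] .
    then show ?thesis using X_measurable[OF v] Pset by (subst (asm) AE_distr_iff) auto
  qed
  then have "AE \<omega> in M. \<forall>v\<in>nodes. ?P (X v \<omega>)" by (subst AE_ball_countable) auto
  then show ?thesis unfolding iff .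
qed

lemma rho_eq:
  assumes "AE \<omega> in M. \<forall>i\<in>child_indices (N [] \<omega>). C [i] \<omega> \<ge> 0"
  shows "rho M N C \<beta> = (\<integral>\<^sup>+u. (\<Sum>j. ennreal (child_weight j u powr \<beta>)) \<partial>root_law)"
proof -
  have hm: "(\<lambda>u. \<Sum>j. ennreal (child_weight j u powr \<beta>)) \<in> borel_measurable node_vector_algebra" by measurable
  have "rho M N C \<beta> = (\<integral>\<^sup>+\<omega>. (\<Sum>j. ennreal (child_weight j (X [] \<omega>) powr \<beta>)) \<partial>M)"
    unfolding rho_def infsum_child_indices
  proof (rule nn_integral_cong_AE)
    show "AE \<omega> in M. (\<Sum>j. if Suc j \<in> child_indices (N [] \<omega>) then ennreal (C [Suc j] \<omega> powr \<beta>) else 0)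
      = (\<Sum>j. ennreal (child_weight j (X [] \<omega>) powr \<beta>))"
      using assms
    proof eventually_elim
      case (elim \<omega>)
      then show ?case
        by (intro suminf_cong) (auto simp: child_weight_def node_vector_def max_def)
    qed
  qed
  then show ?thesis using root_law_transfer[OF Nil_node hm] by simp
qed

lemma root_weight_law:
  assumes pos: "AE \<omega> in M. \<forall>i\<in>child_indices (N [] \<omega>). C [i] \<omega> \<ge> 0"
    and \<alpha>: "1 < \<alpha>" "\<alpha> < b"
    and rv: "(\<lambda>x. measure M {\<omega> \<in> space M. root_sum N C \<omega> > ennreal x}) \<in> regularly_varying (- \<alpha>)"
    and \<rho>: "rho M N C 1 < \<infinity>" "rho M N C b < \<infinity>"
  shows "weight_law root_law child_weight (\<lambda>x. measure M {\<omega> \<in> space M. root_sum N C \<omega> > ennreal x}) \<alpha> b"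
proof -
  have Xm [measurable]: "X [] \<in> M \<rightarrow>\<^sub>M node_vector_algebra" by (rule X_measurable[OF Nil_node])
  have [measurable]: "root_sum N C \<in> borel_measurable M"
    unfolding root_sum_eq by measurable
  interpret R: prob_space root_law by (rule prob_space_distr) (rule Xm)
  show ?thesis
  proof
    show "antimono (\<lambda>x. measure M {\<omega> \<in> space M. root_sum N C \<omega> > ennreal x})"
    proof (rule antimonoI)
      fix x y :: real assume "x \<le> y"
      then have "ennreal x \<le> ennreal y" by (rule ennreal_leI)
      then show "measure M {\<omega> \<in> space M. root_sum N C \<omega> > ennreal y} \<le> measure M {\<omega> \<in> space M. root_sum N C \<omega> > ennreal x}"
        by (intro finite_measure_mono) (auto intro: le_less_trans)
    qed
    show "emeasure root_law {u \<in> space root_law. (\<Sum>j. ennreal (child_weight j u)) > ennreal x}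
      = ennreal (measure M {\<omega> \<in> space M. root_sum N C \<omega> > ennreal x})" for x
    proof -
      have A: "{u \<in> space node_vector_algebra. (\<Sum>j. ennreal (child_weight j u)) > ennreal x} \<in> sets node_vector_algebra"
        by measurable
      have "X [] -` {u \<in> space node_vector_algebra. (\<Sum>j. ennreal (child_weight j u)) > ennreal x} \<inter> space M
        = {\<omega> \<in> space M. root_sum N C \<omega> > ennreal x}"
        unfolding root_sum_eq using measurable_space[OF Xm] by auto
      then show ?thesis using emeasure_distr[OF Xm A] by (simp add: emeasure_eq_measure)
    qed
    show "(\<integral>\<^sup>+u. (\<Sum>j. ennreal (child_weight j u)) \<partial>root_law) < \<infinity>"
      using \<rho>(1) unfolding rho_eq[OF pos] by simp
    show "(\<integral>\<^sup>+u. (\<Sum>j. ennreal (child_weight j u powr b)) \<partial>root_law) < \<infinity>"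
      using \<rho>(2) unfolding rho_eq[OF pos] .
  qed (use \<alpha> rv in auto)
qed

end

text \<open>The path weight from \<open>v\<close> down to \<open>v @ w\<close>, unfolded from the top to match the recursion of
  \<^const>\<open>subtree_sum\<close>.\<close>

primrec descent_weight :: "(nat list \<Rightarrow> real \<times> enat \<times> (nat \<Rightarrow> real)) \<Rightarrow> nat list \<Rightarrow> nat list \<Rightarrow> ennreal" where
  "descent_weight f v [] = 1"
| "descent_weight f v (j # w) = ennreal (child_weight (j - 1) (f v)) * descent_weight f (v @ [j]) w"

lemma descent_weight_snoc:
  "descent_weight f v (w @ [j]) = descent_weight f v w * ennreal (child_weight (j - 1) (f (v @ w)))"
  by (induction w arbitrary: v) (auto simp: mult.assoc)

text \<open>Finite subsets are enough, since they bound the unordered sum that defines \<open>W\<^sub>n\<close>.\<close>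

lemma finite_generation_le_subtree_sum:
  assumes "finite F" "F \<subseteq> {w \<in> nodes. length w = n}"
  shows "(\<Sum>w\<in>F. ennreal (fst (f (v @ w))) * descent_weight f v w) \<le> subtree_sum n v f"
  using assms
proof (induction n arbitrary: v F)
  case 0
  then have "F \<subseteq> {[]}" by auto
  then have "F = {} \<or> F = {[]}" by auto
  then show ?case by auto
next
  case (Suc n)
  define J where "J = {j. \<exists>w. Suc j # w \<in> F}"
  define T where "T j = {w. Suc j # w \<in> F}" for j
  let ?h = "\<lambda>w. ennreal (fst (f (v @ w))) * descent_weight f v w"
  have Feq: "F = (\<lambda>(j, w). Suc j # w) ` Sigma J T"
  proof -
    have "\<exists>j w'. w = Suc j # w'" if "w \<in> F" for w
    proof -
      have "length w = Suc n" "w \<in> nodes" using Suc.prems that by auto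
      then obtain i w' where w: "w = i # w'" "1 \<le> i" by (cases w) (auto simp: nodes_def)
      then show ?thesis by (cases i) auto
    qed
    then show ?thesis unfolding J_def T_def by (force simp: image_iff)
  qed
  have inj: "inj_on (\<lambda>(j, w). Suc j # w) (Sigma J T)" by (auto simp: inj_on_def)
  have "finite (Sigma J T)" using Suc.prems(1) inj unfolding Feq by (rule finite_imageD)
  moreover have "J = fst ` Sigma J T" unfolding J_def T_def by force
  ultimately have J: "finite J" by (metis finite_imageI)
  have T: "finite (T j)" for j
  proof -
    have "finite ((#) (Suc j) ` T j)" by (rule finite_subset[OF _ Suc.prems(1)]) (auto simp: T_def)
    then show ?thesis by (rule finite_imageD) (auto simp: inj_on_def)
  qed
  have Tn: "T j \<subseteq> {w \<in> nodes. length w = n}" for j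
    using Suc.prems(2) unfolding T_def nodes_def by fastforce
  have "(\<Sum>w\<in>F. ?h w) = (\<Sum>z\<in>Sigma J T. ?h (Suc (fst z) # snd z))"
    unfolding Feq by (subst sum.reindex[OF inj]) (auto intro!: sum.cong)
  also have "\<dots> = (\<Sum>j\<in>J. \<Sum>w\<in>T j. ?h (Suc j # w))"
    using J T by (subst sum.Sigma) (auto simp: case_prod_beta)
  also have "\<dots> = (\<Sum>j\<in>J. ennreal (child_weight j (f v)) *
      (\<Sum>w\<in>T j. ennreal (fst (f ((v @ [Suc j]) @ w))) * descent_weight f (v @ [Suc j]) w))"
    by (simp add: sum_distrib_left mult_ac)
  also have "\<dots> \<le> (\<Sum>j\<in>J. ennreal (child_weight j (f v)) * subtree_sum n (v @ [Suc j]) f)"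
    by (intro sum_mono mult_left_mono Suc.IH T Tn) simp
  also have "\<dots> \<le> subtree_sum (Suc n) v f"
    using J by (auto intro: sum_le_suminf)
  finally show ?case .
qed

context weighted_branching_tree
begin

lemma generation_path_weight:
  assumes pos: "\<forall>v\<in>nodes. \<forall>j\<in>child_indices (N v \<omega>). C (v @ [j]) \<omega> \<ge> 0"
  shows "w \<in> generation N n \<omega> \<Longrightarrow> w \<in> nodes \<and> length w = n \<and> 0 \<le> path_weight C w \<omega> \<and>
    ennreal (path_weight C w \<omega>) = descent_weight (\<lambda>v. X v \<omega>) [] w"
proof (induction n arbitrary: w)
  case 0
  then show ?case by (simp add: nodes_def)
next
  case (Suc n)
  then obtain v j where w: "w = v @ [j]" "v \<in> generation N n \<omega>" "j \<in> child_indices (N v \<omega>)" by auto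
  note IH = Suc.IH[OF w(2)]
  have j: "1 \<le> j" using w(3) unfolding child_indices_def by simp
  have C: "0 \<le> C (v @ [j]) \<omega>" using pos IH w(3) by auto
  have cw: "child_weight (j - 1) (X v \<omega>) = C (v @ [j]) \<omega>"
    using j C w(3) by (simp add: child_weight_def node_vector_def)
  have "ennreal (path_weight C w \<omega>) = descent_weight (\<lambda>v. X v \<omega>) [] v * ennreal (C (v @ [j]) \<omega>)"
    using C IH unfolding w(1) by (simp add: ennreal_mult mult.commute)
  also have "\<dots> = descent_weight (\<lambda>v. X v \<omega>) [] w"
    unfolding w(1) descent_weight_snoc using cw by simp
  finally show ?case using IH C j w(1) by (auto simp: nodes_def)
qed

text \<open>Every finite partial sum of \<open>W\<^sub>n\<close> is at most the branch sum at the root; a limit inherits the bound, and if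
  there is no limit, the default value 0 of the sum satisfies it as well.\<close>

lemma generation_sum_le_branch_sum:
  assumes pos: "\<forall>v\<in>nodes. \<forall>j\<in>child_indices (N v \<omega>). C (v @ [j]) \<omega> \<ge> 0"
  shows "generation_sum Q N C n \<omega> \<le> enn2ereal (branch_sum n [] \<omega>)"
proof (cases "(\<lambda>v. ereal (Q v \<omega> * path_weight C v \<omega>)) summable_on generation N n \<omega>")
  case True
  show ?thesis unfolding generation_sum_def
  proof (rule infsum_le_finite_sums[OF True])
    fix F assume F: "finite F" "F \<subseteq> generation N n \<omega>"
    note gen = generation_path_weight[OF pos, of _ n]
    have "(\<Sum>v\<in>F. ereal (Q v \<omega> * path_weight C v \<omega>)) \<le> (\<Sum>v\<in>F. enn2ereal (ennreal (Q v \<omega>) * ennreal (path_weight C v \<omega>)))"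
    proof (rule sum_mono)
      fix v assume "v \<in> F"
      then have p: "0 \<le> path_weight C v \<omega>" using gen F by blast
      have "Q v \<omega> * path_weight C v \<omega> \<le> max 0 (Q v \<omega>) * path_weight C v \<omega>" using p by (intro mult_right_mono) auto
      then show "ereal (Q v \<omega> * path_weight C v \<omega>) \<le> enn2ereal (ennreal (Q v \<omega>) * ennreal (path_weight C v \<omega>))"
        using p by (simp add: times_ennreal.rep_eq ennreal.rep_eq max_def split: if_splits)
    qed
    also have "\<dots> = enn2ereal (\<Sum>v\<in>F. ennreal (Q v \<omega>) * ennreal (path_weight C v \<omega>))"
      by (simp add: sum_enn2ereal)
    also have "(\<Sum>v\<in>F. ennreal (Q v \<omega>) * ennreal (path_weight C v \<omega>))
      = (\<Sum>w\<in>F. ennreal (fst (X ([] @ w) \<omega>)) * descent_weight (\<lambda>v. X v \<omega>) [] w)"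
      using gen F by (intro sum.cong) (auto simp: node_vector_def)
    also have "enn2ereal \<dots> \<le> enn2ereal (branch_sum n [] \<omega>)"
      unfolding branch_sum_def less_eq_ennreal.rep_eq[symmetric]
      using gen F by (intro finite_generation_le_subtree_sum) auto
    finally show "(\<Sum>v\<in>F. ereal (Q v \<omega> * path_weight C v \<omega>)) \<le> enn2ereal (branch_sum n [] \<omega>)" .
  qed
next
  case False
  then show ?thesis unfolding generation_sum_def by (simp add: infsum_not_exists)
qed

lemma generation_tail_le:
  assumes "AE \<omega> in M. \<forall>i\<in>child_indices (N [] \<omega>). C [i] \<omega> \<ge> 0" and x: "0 \<le> x"
  shows "emeasure M {\<omega> \<in> space M. max (generation_sum Q N C n \<omega>) 0 > ereal x}
    \<le> emeasure M {\<omega> \<in> space M. branch_sum n [] \<omega> > ennreal x}"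
proof (rule emeasure_mono_AE)
  have [measurable]: "branch_sum n [] \<in> borel_measurable M" by (rule branch_sum_measurable[OF Nil_node])
  show "{\<omega> \<in> space M. branch_sum n [] \<omega> > ennreal x} \<in> sets M" by measurable
  show "AE \<omega> in M. \<omega> \<in> {\<omega> \<in> space M. max (generation_sum Q N C n \<omega>) 0 > ereal x}
    \<longrightarrow> \<omega> \<in> {\<omega> \<in> space M. branch_sum n [] \<omega> > ennreal x}"
    using nonneg_weights[OF assms(1)]
  proof eventually_elim
    case (elim \<omega>)
    have "ereal x < enn2ereal (branch_sum n [] \<omega>)" if "max (generation_sum Q N C n \<omega>) 0 > ereal x"
      using that x generation_sum_le_branch_sum[OF elim, of n] by (auto simp: less_max_iff_disj)
    then show ?case using x by (auto simp: less_ennreal.rep_eq ennreal.rep_eq)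
  qed
qed

end

theorem proposition3p2:
  fixes M :: "'a measure"
    and Q :: "nat list \<Rightarrow> 'a \<Rightarrow> real"
    and N :: "nat list \<Rightarrow> 'a \<Rightarrow> enat"
    and C :: "nat list \<Rightarrow> 'a \<Rightarrow> real"
    and \<alpha> \<epsilon> \<eta> :: real
  assumes "weighted_branching_tree M Q N C"
    and "AE \<omega> in M. \<forall>i\<in>child_indices (N [] \<omega>). C [i] \<omega> \<ge> 0"
    and "measure M {\<omega> \<in> space M. \<bar>Q [] \<omega>\<bar> > 0} > 0"
    and "\<alpha> > 1"
    and "(\<lambda>x. measure M {\<omega> \<in> space M. root_sum N C \<omega> > ennreal x}) \<in> regularly_varying (- \<alpha>)"
    and "\<epsilon> > 0"
    and "(\<integral>\<^sup>+\<omega>. ennreal (max (Q [] \<omega>) 0 powr (\<alpha> + \<epsilon>)) \<partial>M) < \<infinity>"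
    and "rho M N C (\<alpha> + \<epsilon>) < \<infinity>"
    and "max (rho M N C 1) (rho M N C \<alpha>) < ennreal \<eta>"
    and "\<eta> < 1"
  shows "\<exists>K>0. \<forall>n\<ge>1. \<forall>x\<ge>1.
    measure M {\<omega> \<in> space M. max (generation_sum Q N C n \<omega>) 0 > ereal x}
      \<le> K * \<eta> ^ n * measure M {\<omega> \<in> space M. root_sum N C \<omega> > ennreal x}"
proof -
  interpret weighted_branching_tree M Q N C by (rule assms(1))
  have \<rho>: "rho M N C 1 < ennreal \<eta>" "rho M N C \<alpha> < ennreal \<eta>" using assms(9) by auto
  have \<eta>: "0 < \<eta>" using \<rho>(1) by (cases "0 < \<eta>") (auto simp: ennreal_neg)
  have \<rho>1: "rho M N C 1 < \<infinity>" using less_trans[OF \<rho>(1) ennreal_less_top] by simp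
  have law: "weight_law root_law child_weight (\<lambda>x. measure M {\<omega> \<in> space M. root_sum N C \<omega> > ennreal x}) \<alpha> (\<alpha> + \<epsilon>)"
    using assms(4,6) by (intro root_weight_law assms(2,5,8) \<rho>1) auto
  have r1: "(\<integral>\<^sup>+u. (\<Sum>j. ennreal (child_weight j u)) \<partial>root_law) \<le> ennreal \<eta>"
    using less_imp_le[OF \<rho>(1)] unfolding rho_eq[OF assms(2)] by simp
  have ra: "(\<integral>\<^sup>+u. (\<Sum>j. ennreal (child_weight j u powr \<alpha>)) \<partial>root_law) < ennreal \<eta>"
    using \<rho>(2) unfolding rho_eq[OF assms(2)] .
  obtain K where K: "0 < K" "\<And>n v x. v \<in> nodes \<Longrightarrow> 1 \<le> x \<Longrightarrow>
    emeasure M {\<omega> \<in> space M. branch_sum n v \<omega> > ennreal x}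
      \<le> ennreal (K * \<eta> ^ n * measure M {\<omega> \<in> space M. root_sum N C \<omega> > ennreal x})"
    using branch_sum_tail[OF law assms(7) r1 ra \<eta> less_imp_le[OF assms(10)]] by blast
  have "measure M {\<omega> \<in> space M. max (generation_sum Q N C n \<omega>) 0 > ereal x}
      \<le> K * \<eta> ^ n * measure M {\<omega> \<in> space M. root_sum N C \<omega> > ennreal x}" if x: "1 \<le> x" for n x
  proof -
    have "emeasure M {\<omega> \<in> space M. max (generation_sum Q N C n \<omega>) 0 > ereal x}
      \<le> ennreal (K * \<eta> ^ n * measure M {\<omega> \<in> space M. root_sum N C \<omega> > ennreal x})"
      using generation_tail_le[OF assms(2), of x n] K(2)[OF Nil_node x, of n] x by (auto intro: order_trans)
    then have "ennreal (measure M {\<omega> \<in> space M. max (generation_sum Q N C n \<omega>) 0 > ereal x})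
      \<le> ennreal (K * \<eta> ^ n * measure M {\<omega> \<in> space M. root_sum N C \<omega> > ennreal x})"
      by (simp add: emeasure_eq_measure)
    then show ?thesis using K(1) \<eta> by (simp add: ennreal_le_iff)
  qed
  then show ?thesis using K(1) by blast
qed

end
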